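(* Let $n\ge 2$, $p\ge 1$, and let $L_1,\dots,L_{n-1}\subset\mathbb R^n$ be convex bodies. Let $N_p(L_1,\dots,L_{n-1})$ be the convex body with support function $$h(N_p(L_1,\dots,L_{n-1}),\xi)^p=\int_{L_1}\cdots\int_{L_{n-1}} D_n(x_1,\dots,x_{n-1},\xi)^p\,dx_1\cdots dx_{n-1},$$ and let $N_p^\circ(L_1,\dots,L_{n-1})$ be its polar body. Then $$\operatorname{vol}(N_p^\circ(L_1,\dots,L_{n-1}))\le a_{n,p}\prod_{i=1}^{n-1}\operatorname{vol}(L_i)^{-\frac{n+p}{p}},\qquad a_{n,p}=\Big(\frac{n+p}{n}\,b_{n,p}\Big)^{-\frac np}.$$
   Context: A convex body in $\mathbb R^n$ is a compact convex set with non-empty interior; $\operatorname{vol}$ is Lebesgue measure. $D_n(v_1,\dots,v_n)=|\det(v_1,\dots,v_n)|$. The support function of $K$ is $h(K,y)=\max\{\langle y,z\rangle: z\in K\}$, and the polar body of $K$ is $K^\circ=\{x\in\mathbb R^n: h(K,x)\le 1\}$. The constant $b_{n,p}$ is the sharp constant in the $L_p$-Busemann random simplex inequality $\int_{L_1}\cdots\int_{L_n}D_n(x_1,\dots,x_n)^p\,dx_1\cdots dx_n\ge b_{n,p}\prod_{i=1}^n\operatorname{vol}(L_i)^{\frac{n+p}{n}}$ for convex bodies, for which equality holds when the $L_i$ are homothetic origin-symmetric ellipsoids. Explicitly, $b_{n,p}=\omega_n^{-(n+p)}\int_{B}\cdots\int_{B}D_n(x_1,\dots,x_n)^p\,dx_1\cdots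 dx_n$, where $B$ is the Euclidean unit ball and $\omega_n=\operatorname{vol}(B)$. *)

theory Defs
  imports "HOL-Analysis.Analysis"
begin

text \<open>
  Dimension \<open>n\<close> is \<open>CARD('n)\<close> and Euclidean space is \<open>real ^ 'n\<close>. An \<open>n\<close>-tuple of vectors is a
  function on \<open>'n\<close>; an \<open>(n - 1)\<close>-tuple is a function on \<open>UNIV - {k}\<close>, where the index \<open>k :: 'n\<close>
  marks the free slot of the determinant. The choice of \<open>k\<close> is immaterial, since permuting
  columns preserves the absolute value of a determinant.
\<close>

definition convex_body :: "'a::euclidean_space set \<Rightarrow> bool" where
  "convex_body K \<longleftrightarrow> compact K \<and> convex K \<and> interior K \<noteq> {}"

abbreviation vol :: "'a::euclidean_space set \<Rightarrow> real" where
  "vol K \<equiv> measure lebesgue K"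

definition support_fun :: "'a::euclidean_space set \<Rightarrow> 'a \<Rightarrow> real" where
  "support_fun K y = (SUP z\<in>K. y \<bullet> z)"

definition polar_body :: "'a::euclidean_space set \<Rightarrow> 'a set" where
  "polar_body K = {x. support_fun K x \<le> 1}"

definition abs_det :: "('n::finite \<Rightarrow> real ^ 'n) \<Rightarrow> real" where
  "abs_det v = \<bar>det (\<chi> i j. v j $ i)\<bar>"

definition simplex_moment ::
  "real \<Rightarrow> 'n::finite \<Rightarrow> ('n \<Rightarrow> (real ^ 'n) set) \<Rightarrow> real ^ 'n \<Rightarrow> real" where
  "simplex_moment p k L \<xi> =
     (LINT x : Pi\<^sub>E (UNIV - {k}) L | Pi\<^sub>M (UNIV - {k}) (\<lambda>_. lborel). abs_det (x(k := \<xi>)) powr p)"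

text \<open>
  Nonnegativity of the support function is implicit in taking its real power \<open>p\<close>; it is spelled
  out because \<open>powr\<close> is total and has values at negative arguments too.
\<close>

definition N_body :: "real \<Rightarrow> 'n::finite \<Rightarrow> ('n \<Rightarrow> (real ^ 'n) set) \<Rightarrow> (real ^ 'n) set" where
  "N_body p k L =
     (THE N. convex_body N \<and>
        (\<forall>\<xi>. 0 \<le> support_fun N \<xi> \<and> support_fun N \<xi> powr p = simplex_moment p k L \<xi>))"

definition b_const :: "'n::finite itself \<Rightarrow> real \<Rightarrow> real" where
  "b_const _ p =
     vol (cball (0 :: real ^ 'n) 1) powr (- (real CARD('n) + p)) *
     (LINT x : Pi\<^sub>E UNIV (\<lambda>_. cball 0 1) | Pi\<^sub>M UNIV (\<lambda>_. lborel).
        abs_det (x :: 'n \<Rightarrow> real ^ 'n) powr p)"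

definition a_const :: "'n::finite itself \<Rightarrow> real \<Rightarrow> real" where
  "a_const T p =
     ((real CARD('n) + p) / real CARD('n) * b_const T p) powr (- (real CARD('n) / p))"

end

theory Submission
  imports Defs
begin

text \<open>
  Let \<open>M \<xi>\<close> be the moment that defines the body and \<open>P = {\<xi>. M \<xi> \<le> 1}\<close> its polar body.
  If \<open>P\<close> is put into the free slot of the determinant, the full moment of \<open>L\<close> and \<open>P\<close>
  is the integral of \<open>M\<close> over \<open>P\<close>. Since \<open>M\<close> is homogeneous of degree \<open>p\<close>, this integral
  is \<open>n / (n + p)\<close> times the volume of \<open>P\<close> (\<open>nn_integral_homogeneous_sublevel\<close>). The random
  simplex inequality (\<open>busemann_random_simplex\<close>) bounds it from below by a multiple of the
  volume of \<open>P\<close> to the power \<open>(n + p) / n\<close>. Solving for the volume gives the claim.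

  The random simplex inequality is proved by Steiner symmetrization. Symmetrizing all sets in a
  common direction recentres their chords; along the chords the determinant is a linear function
  of the positions, and by convexity of \<open>\<bar>t\<bar> powr p\<close> the centred position minimizes the moment
  (\<open>det_moment_steiner_le\<close>). It remains to reach balls. Let \<open>B i\<close> be the ball with the volume of
  \<open>S i\<close>. If a translation by a vector \<open>v\<close> carries a part of \<open>S i - B i\<close> into \<open>B i - S i\<close>, then
  symmetrizing along \<open>v\<close> enlarges the overlap of \<open>S i\<close> and \<open>B i\<close> at least by the volume of this part
  (\<open>steiner_overlap_gain\<close>). Averaging over \<open>v\<close> shows that some \<open>v\<close> decreases the total volume of the
  \<open>B i - S i\<close> by a fixed multiple of its square (\<open>deficit_steiner_gain\<close>), so this volume can be
  made arbitrarily small (\<open>competitor_close_to_balls\<close>). All sets stay in one fixed ball, where the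
  determinant is bounded, and the moment of the balls is therefore a lower bound
  (\<open>det_moment_balls_le\<close>).

  The body itself exists and is unique because the \<open>p\<close>-th root of \<open>M\<close> is sublinear and positive
  away from the origin (\<open>sublinear_gauge_moment\<close>, \<open>support_fun_N_body\<close>). Positivity holds
  because random columns are almost surely linearly independent (\<open>AE_det_nonzero\<close>).
\<close>

section \<open>Integration over tuples and along parallel chords\<close>

interpretation lborel_PiM:
  product_sigma_finite "\<lambda>_::'i. lborel :: 'a::euclidean_space measure"
  by standard

abbreviation lborel_tuples :: "('i \<Rightarrow> 'a::euclidean_space) measure" where
  "lborel_tuples \<equiv> Pi\<^sub>M UNIV (\<lambda>_. lborel)"

lemma nn_integral_translate:
  fixes f :: "'a::euclidean_space \<Rightarrow> ennreal"
  assumes [measurable]: "f \<in> borel_measurable borel"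
  shows "(\<integral>\<^sup>+x. f (x + c) \<partial>lborel) = (\<integral>\<^sup>+x. f x \<partial>lborel)"
proof -
  have "(\<integral>\<^sup>+x. f x \<partial>lborel) = (\<integral>\<^sup>+x. f x \<partial>distr lborel borel ((+) c))"
    by (simp add: lborel_distr_plus)
  also have "\<dots> = (\<integral>\<^sup>+x. f (x + c) \<partial>lborel)"
    by (subst nn_integral_distr) (auto simp: add.commute)
  finally show ?thesis by simp
qed

text \<open>
  A product measure is determined by its values on boxes, and these factor over the coordinates.
\<close>

lemma distr_lborel_tuples_componentwise:
  fixes g :: "'i::finite \<Rightarrow> 'a::euclidean_space \<Rightarrow> 'a"
  assumes [measurable]: "\<And>i. g i \<in> borel_measurable borel"
    and inv: "\<And>i. distr lborel lborel (g i) = lborel"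
  shows "distr lborel_tuples lborel_tuples (\<lambda>x i. g i (x i)) = lborel_tuples"
proof (rule lborel_PiM.PiM_eqI)
  have meas: "(\<lambda>x i. g i (x i)) \<in> measurable (lborel_tuples :: ('i \<Rightarrow> 'a) measure) lborel_tuples"
    by (rule measurable_PiM_single') (auto simp: space_PiM)
  fix A :: "'i \<Rightarrow> 'a set"
  assume A: "\<And>i. i \<in> UNIV \<Longrightarrow> A i \<in> sets lborel"
  have [measurable]: "A i \<in> sets borel" for i using A[of i] by simp
  have "emeasure (distr lborel_tuples lborel_tuples (\<lambda>x i. g i (x i))) (Pi\<^sub>E UNIV A)
      = emeasure lborel_tuples (Pi\<^sub>E UNIV (\<lambda>i. g i -` A i))"
    by (subst emeasure_distr[OF meas])
       (auto intro!: sets_PiM_I_finite arg_cong2[where f=emeasure] simp: space_PiM PiE_iff)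
  also have "\<dots> = (\<Prod>i\<in>UNIV. emeasure lborel (g i -` A i))"
    by (subst lborel_PiM.emeasure_PiM) (auto simp: measurable_sets_borel[of "g _" borel])
  also have "\<dots> = (\<Prod>i\<in>UNIV. emeasure (distr lborel lborel (g i)) (A i))"
    by (intro prod.cong refl, subst emeasure_distr) auto
  finally show "emeasure (distr lborel_tuples lborel_tuples (\<lambda>x i. g i (x i))) (Pi\<^sub>E UNIV A)
      = (\<Prod>i\<in>UNIV. emeasure lborel (A i))"
    by (simp add: inv)
qed auto

lemma nn_integral_lborel_tuples_componentwise:
  fixes g :: "'i::finite \<Rightarrow> 'a::euclidean_space \<Rightarrow> 'a"
  assumes g[measurable]: "\<And>i. g i \<in> borel_measurable borel"
    and inv: "\<And>i. distr lborel lborel (g i) = lborel"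
    and f[measurable]: "f \<in> borel_measurable lborel_tuples"
  shows "(\<integral>\<^sup>+x. f (\<lambda>i. g i (x i)) \<partial>lborel_tuples) = (\<integral>\<^sup>+x. f x \<partial>lborel_tuples)"
proof -
  have meas: "(\<lambda>x i. g i (x i)) \<in> measurable (lborel_tuples :: ('i \<Rightarrow> 'a) measure) lborel_tuples"
    by (rule measurable_PiM_single') (auto simp: space_PiM)
  have "(\<integral>\<^sup>+x. f x \<partial>lborel_tuples) = (\<integral>\<^sup>+x. f x \<partial>distr lborel_tuples lborel_tuples (\<lambda>x i. g i (x i)))"
    by (simp add: distr_lborel_tuples_componentwise[OF g inv])
  also have "\<dots> = (\<integral>\<^sup>+x. f (\<lambda>i. g i (x i)) \<partial>lborel_tuples)"
    by (rule nn_integral_distr[OF meas]) simp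
  finally show ?thesis by simp
qed

lemma nn_integral_lborel_tuples_translate:
  fixes f :: "('i::finite \<Rightarrow> 'a::euclidean_space) \<Rightarrow> ennreal"
  assumes "f \<in> borel_measurable lborel_tuples"
  shows "(\<integral>\<^sup>+x. f (\<lambda>i. x i + c i) \<partial>lborel_tuples) = (\<integral>\<^sup>+x. f x \<partial>lborel_tuples)"
proof (rule nn_integral_lborel_tuples_componentwise[OF _ _ assms])
  show "distr lborel lborel (\<lambda>x. x + c i) = (lborel :: 'a measure)" for i
    using lborel_distr_plus[of "c i"] by (simp add: add.commute cong: distr_cong)
qed simp

lemma nn_integral_lborel_tuples_uminus:
  fixes f :: "('i::finite \<Rightarrow> real) \<Rightarrow> ennreal"
  assumes "f \<in> borel_measurable lborel_tuples"
  shows "(\<integral>\<^sup>+x. f (\<lambda>i. - x i) \<partial>lborel_tuples) = (\<integral>\<^sup>+x. f x \<partial>lborel_tuples)"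
  by (rule nn_integral_lborel_tuples_componentwise[OF _ _ assms])
     (simp_all add: lborel_distr_uminus cong: distr_cong)

text \<open>
  The unit slab orthogonal to \<open>u\<close> meets every line parallel to \<open>u\<close> in a segment of length one.
  Averaging translates over it therefore splits an integral into integrals over parallel chords,
  by translation invariance and Tonelli alone: no orthogonal decomposition of the space is chosen.
\<close>

definition slab :: "'a::euclidean_space \<Rightarrow> 'a set" where
  "slab u = {x. 0 \<le> x \<bullet> u \<and> x \<bullet> u < 1}"

lemma slab_measurable [measurable]: "slab u \<in> sets borel"
  unfolding slab_def by measurable

lemma nn_integral_slab_shift:
  assumes "norm u = 1"
  shows "(\<integral>\<^sup>+t. indicator (slab u) (y - t *\<^sub>R u) \<partial>lborel) = (1::ennreal)"
proof -
  have uu: "u \<bullet> u = 1" using assms by (simp add: dot_square_norm)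
  have "(\<integral>\<^sup>+t. indicator (slab u) (y - t *\<^sub>R u) \<partial>lborel)
      = (\<integral>\<^sup>+t. (indicator {y \<bullet> u - 1 <.. y \<bullet> u} t :: ennreal) \<partial>lborel)"
    by (intro nn_integral_cong) (auto simp: slab_def indicator_def inner_diff_left uu)
  also have "\<dots> = 1" by simp
  finally show ?thesis .
qed

text \<open>
  Substituting \<open>x - t *\<^sub>R u\<close> for \<open>x\<close> on the right moves the shift to the indicator of the slab,
  whose integral over \<open>t\<close> is one.
\<close>

theorem nn_integral_by_chords:
  fixes f :: "'a::euclidean_space \<Rightarrow> ennreal"
  assumes [measurable]: "f \<in> borel_measurable borel" and u: "norm u = 1"
  shows "(\<integral>\<^sup>+x. f x \<partial>lborel)
    = (\<integral>\<^sup>+x. indicator (slab u) x * (\<integral>\<^sup>+t. f (x + t *\<^sub>R u) \<partial>lborel) \<partial>lborel)"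
proof -
  have "(\<integral>\<^sup>+x. indicator (slab u) x * (\<integral>\<^sup>+t. f (x + t *\<^sub>R u) \<partial>lborel) \<partial>lborel)
      = (\<integral>\<^sup>+x. (\<integral>\<^sup>+t. indicator (slab u) x * f (x + t *\<^sub>R u) \<partial>lborel) \<partial>lborel)"
    by (simp add: nn_integral_cmult)
  also have "\<dots> = (\<integral>\<^sup>+t. (\<integral>\<^sup>+x. indicator (slab u) x * f (x + t *\<^sub>R u) \<partial>lborel) \<partial>(lborel::real measure))"
    by (rule lborel_pair.Fubini') measurable
  also have "\<dots> = (\<integral>\<^sup>+t. (\<integral>\<^sup>+x. indicator (slab u) (x - t *\<^sub>R u) * f x \<partial>lborel) \<partial>(lborel::real measure))"
  proof (rule nn_integral_cong)
    fix t :: real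
    show "(\<integral>\<^sup>+x. indicator (slab u) x * f (x + t *\<^sub>R u) \<partial>lborel)
        = (\<integral>\<^sup>+x. indicator (slab u) (x - t *\<^sub>R u) * f x \<partial>lborel)"
      using nn_integral_translate[of "\<lambda>x. indicator (slab u) (x - t *\<^sub>R u) * f x" "t *\<^sub>R u"] by simp
  qed
  also have "\<dots> = (\<integral>\<^sup>+x. (\<integral>\<^sup>+t. indicator (slab u) (x - t *\<^sub>R u) * f x \<partial>lborel) \<partial>lborel)"
    by (rule lborel_pair.Fubini') measurable
  also have "\<dots> = (\<integral>\<^sup>+x. f x \<partial>lborel)"
    by (simp add: nn_integral_multc nn_integral_slab_shift[OF u])
  finally show ?thesis by simp
qed

lemma measurable_tuple_line:
  "(\<lambda>(x, t). \<lambda>i. x i + t i *\<^sub>R u)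
    \<in> measurable (lborel_tuples \<Otimes>\<^sub>M lborel_tuples) (lborel_tuples :: ('i::finite \<Rightarrow> 'a::euclidean_space) measure)"
  by (rule measurable_PiM_single') (auto simp: space_PiM case_prod_unfold)

theorem nn_integral_tuples_by_chords:
  fixes f :: "('i::finite \<Rightarrow> 'a::euclidean_space) \<Rightarrow> ennreal"
  assumes f[measurable]: "f \<in> borel_measurable lborel_tuples" and u: "norm u = 1"
  shows "(\<integral>\<^sup>+x. f x \<partial>lborel_tuples)
    = (\<integral>\<^sup>+x. (\<Prod>i\<in>UNIV. indicator (slab u) (x i)) *
          (\<integral>\<^sup>+t. f (\<lambda>i. x i + t i *\<^sub>R u) \<partial>lborel_tuples) \<partial>lborel_tuples)"
proof -
  interpret X: sigma_finite_measure "lborel_tuples :: ('i \<Rightarrow> 'a) measure"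
    by (rule lborel_PiM.sigma_finite) simp
  interpret T: sigma_finite_measure "lborel_tuples :: ('i \<Rightarrow> real) measure"
    by (rule lborel_PiM.sigma_finite) simp
  interpret XT: pair_sigma_finite "lborel_tuples :: ('i \<Rightarrow> 'a) measure" "lborel_tuples :: ('i \<Rightarrow> real) measure"
    by standard
  let ?w = "\<lambda>x::'i \<Rightarrow> 'a. \<Prod>i\<in>UNIV. indicator (slab u) (x i) :: ennreal"
  have fl[measurable]: "(\<lambda>(x, t). f (\<lambda>i. x i + t i *\<^sub>R u)) \<in> borel_measurable (lborel_tuples \<Otimes>\<^sub>M lborel_tuples)"
    using measurable_compose[OF measurable_tuple_line f] by (simp add: case_prod_unfold)
  have fx: "(\<lambda>t. f (\<lambda>i. x i + t i *\<^sub>R u)) \<in> borel_measurable lborel_tuples" for x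
    by (rule measurable_compose[OF _ f]) (rule measurable_PiM_single', auto simp: space_PiM)
  have "(\<integral>\<^sup>+x. ?w x * (\<integral>\<^sup>+t. f (\<lambda>i. x i + t i *\<^sub>R u) \<partial>lborel_tuples) \<partial>lborel_tuples)
      = (\<integral>\<^sup>+x. (\<integral>\<^sup>+t. ?w x * f (\<lambda>i. x i + t i *\<^sub>R u) \<partial>lborel_tuples) \<partial>lborel_tuples)"
    by (simp add: nn_integral_cmult fx)
  also have "\<dots> = (\<integral>\<^sup>+t. (\<integral>\<^sup>+x. ?w x * f (\<lambda>i. x i + t i *\<^sub>R u) \<partial>lborel_tuples) \<partial>lborel_tuples)"
    by (rule XT.Fubini'[symmetric]) measurable
  also have "\<dots> = (\<integral>\<^sup>+t. (\<integral>\<^sup>+x. ?w (\<lambda>i. x i - t i *\<^sub>R u) * f x \<partial>lborel_tuples) \<partial>lborel_tuples)"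
  proof (rule nn_integral_cong)
    fix t :: "'i \<Rightarrow> real"
    show "(\<integral>\<^sup>+x. ?w x * f (\<lambda>i. x i + t i *\<^sub>R u) \<partial>lborel_tuples)
        = (\<integral>\<^sup>+x. ?w (\<lambda>i. x i - t i *\<^sub>R u) * f x \<partial>lborel_tuples)"
      using nn_integral_lborel_tuples_translate
        [of "\<lambda>x. ?w (\<lambda>i. x i - t i *\<^sub>R u) * f x" "\<lambda>i. t i *\<^sub>R u"] by simp
  qed
  also have "\<dots> = (\<integral>\<^sup>+x. (\<integral>\<^sup>+t. ?w (\<lambda>i. x i - t i *\<^sub>R u) * f x \<partial>lborel_tuples) \<partial>lborel_tuples)"
    by (rule XT.Fubini') measurable
  also have "\<dots> = (\<integral>\<^sup>+x. (\<integral>\<^sup>+t. (\<Prod>i\<in>UNIV. indicator (slab u) (x i - t i *\<^sub>R u)) \<partial>lborel_tuples) * f x \<partial>lborel_tuples)"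
    by (simp add: nn_integral_multc)
  also have "\<dots> = (\<integral>\<^sup>+x. f x \<partial>lborel_tuples)"
    by (subst lborel_PiM.product_nn_integral_prod) (simp_all add: nn_integral_slab_shift[OF u])
  finally show ?thesis by simp
qed

section \<open>Steiner symmetrization\<close>

lemma cball_in_borel [measurable]: "cball a r \<in> sets borel"
  by simp

lemma bounded_borel_fmeasurable:
  fixes S :: "'a::euclidean_space set"
  assumes "S \<in> sets borel" "bounded S"
  shows "S \<in> fmeasurable lborel"
  using assms emeasure_bounded_finite[of S] by (simp add: fmeasurable_def less_top)

definition chord :: "'a::euclidean_space \<Rightarrow> 'a set \<Rightarrow> 'a \<Rightarrow> real set" where
  "chord u S x = {t. x + t *\<^sub>R u \<in> S}"

text \<open>
  The Steiner symmetral replaces each chord by the open segment of the same length centred on the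
  hyperplane orthogonal to \<open>u\<close>. The strict inequality makes chords of length zero disappear;
  otherwise the whole hyperplane would be added and boundedness and convexity would be lost.
\<close>

definition steiner :: "'a::euclidean_space \<Rightarrow> 'a set \<Rightarrow> 'a set" where
  "steiner u S = {x. 2 * \<bar>x \<bullet> u\<bar> < measure lborel (chord u S x)}"

lemma mem_chord: "t \<in> chord u S x \<longleftrightarrow> x + t *\<^sub>R u \<in> S"
  by (simp add: chord_def)

lemma mem_steiner: "x \<in> steiner u S \<longleftrightarrow> 2 * \<bar>x \<bullet> u\<bar> < measure lborel (chord u S x)"
  by (simp add: steiner_def)

lemma chord_measurable [measurable (raw)]:
  assumes [measurable]: "S \<in> sets borel"
  shows "chord u S x \<in> sets borel"
  unfolding chord_def by measurable

lemma emeasure_chord: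
  assumes "S \<in> sets borel"
  shows "emeasure lborel (chord u S x) = (\<integral>\<^sup>+t. indicator S (x + t *\<^sub>R u) \<partial>lborel)"
proof -
  have "(\<integral>\<^sup>+t. indicator S (x + t *\<^sub>R u) \<partial>lborel) = (\<integral>\<^sup>+t. (indicator (chord u S x) t :: ennreal) \<partial>lborel)"
    by (intro nn_integral_cong) (auto simp: chord_def indicator_def)
  then show ?thesis using assms by (simp add: chord_measurable)
qed

lemma emeasure_chord_borel_measurable [measurable (raw)]:
  fixes u :: "'a::euclidean_space"
  assumes [measurable]: "S \<in> sets borel"
  shows "(\<lambda>x. emeasure lborel (chord u S x)) \<in> borel_measurable borel"
proof -
  have "(\<lambda>x. \<integral>\<^sup>+t. indicator S (x + t *\<^sub>R u) \<partial>lborel) \<in> borel_measurable (borel::'a measure)"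
    by measurable
  then show ?thesis by (simp add: emeasure_chord)
qed

lemma steiner_borel [measurable (raw)]:
  assumes [measurable]: "S \<in> sets borel"
  shows "steiner u S \<in> sets borel"
  unfolding steiner_def measure_def by measurable

lemma emeasure_by_chords:
  assumes "S \<in> sets borel" "norm u = 1"
  shows "emeasure lborel S
    = (\<integral>\<^sup>+x. indicator (slab u) x * emeasure lborel (chord u S x) \<partial>lborel)"
  using nn_integral_by_chords[of "indicator S" u] assms by (simp add: emeasure_chord)

lemma emeasure_chord_shift:
  assumes [measurable]: "S \<in> sets borel"
  shows "emeasure lborel (chord u S (x + s *\<^sub>R u)) = emeasure lborel (chord u S x)"
  using nn_integral_translate[of "\<lambda>t. indicator S (x + t *\<^sub>R u)" s]
  by (simp add: emeasure_chord algebra_simps)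

lemma chord_subset:
  assumes "S \<subseteq> cball 0 R" "norm u = 1"
  shows "chord u S x \<subseteq> {- (x \<bullet> u) - R .. - (x \<bullet> u) + R}"
proof
  fix t assume "t \<in> chord u S x"
  then have "norm (x + t *\<^sub>R u) \<le> R" using assms by (auto simp: chord_def)
  moreover have "\<bar>(x + t *\<^sub>R u) \<bullet> u\<bar> \<le> norm (x + t *\<^sub>R u)"
    using Cauchy_Schwarz_ineq2[of "x + t *\<^sub>R u" u] assms by simp
  moreover have "(x + t *\<^sub>R u) \<bullet> u = x \<bullet> u + t"
    using assms by (simp add: inner_add_left dot_square_norm)
  ultimately show "t \<in> {- (x \<bullet> u) - R .. - (x \<bullet> u) + R}" by auto
qed

lemma emeasure_chord_finite:
  assumes "bounded S" "norm u = 1"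
  shows "emeasure lborel (chord u S x) < \<infinity>"
proof -
  obtain R where "S \<subseteq> cball 0 R" using assms by (auto simp: bounded_iff subset_eq)
  then have "emeasure lborel (chord u S x) \<le> emeasure lborel {- (x \<bullet> u) - R .. - (x \<bullet> u) + R}"
    using chord_subset[OF _ assms(2)] by (intro emeasure_mono) auto
  also have "\<dots> < \<infinity>" by (simp add: emeasure_lborel_Icc_eq)
  finally show ?thesis .
qed

lemma emeasure_chord_eq_measure:
  assumes "bounded S" "norm u = 1"
  shows "emeasure lborel (chord u S x) = ennreal (measure lborel (chord u S x))"
  using emeasure_chord_finite[OF assms, of x]
  by (intro emeasure_eq_ennreal_measure) (simp add: less_top)

lemma measure_chord_shift:
  assumes "S \<in> sets borel"
  shows "measure lborel (chord u S (x + s *\<^sub>R u)) = measure lborel (chord u S x)"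
  using emeasure_chord_shift[OF assms] by (simp add: measure_def)

lemma chord_steiner:
  assumes "S \<in> sets borel" "norm u = 1"
  shows "chord u (steiner u S) x = {t. 2 * \<bar>t - (- (x \<bullet> u))\<bar> < measure lborel (chord u S x)}"
proof -
  have "(x + t *\<^sub>R u) \<bullet> u = x \<bullet> u + t" for t
    using assms by (simp add: inner_add_left dot_square_norm)
  then have "t \<in> chord u (steiner u S) x \<longleftrightarrow> 2 * \<bar>x \<bullet> u + t\<bar> < measure lborel (chord u S x)" for t
    using measure_chord_shift[OF assms(1), of u x t]
    by (simp add: mem_chord mem_steiner)
  then show ?thesis by (auto simp: add.commute)
qed

lemma centred_interval: "{t::real. 2 * \<bar>t - a\<bar> < m} = {a - m / 2 <..< a + m / 2}"
  by (auto simp: abs_if field_simps)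

lemma emeasure_centred_interval:
  "0 \<le> m \<Longrightarrow> emeasure lborel {t::real. 2 * \<bar>t - a\<bar> < m} = ennreal m"
  by (simp add: centred_interval)

lemma emeasure_chord_steiner:
  assumes "S \<in> sets borel" "bounded S" "norm u = 1"
  shows "emeasure lborel (chord u (steiner u S) x) = emeasure lborel (chord u S x)"
  unfolding chord_steiner[OF assms(1,3)] emeasure_chord_eq_measure[OF assms(2,3)]
  by (rule emeasure_centred_interval) simp

lemma emeasure_steiner:
  assumes "S \<in> sets borel" "bounded S" "norm u = 1"
  shows "emeasure lborel (steiner u S) = emeasure lborel S"
  using assms by (simp add: emeasure_by_chords[of _ u] steiner_borel emeasure_chord_steiner)

text \<open>
  A chord of a centred ball is already centred, so a chord of \<open>S\<close> cannot outgrow the chord of the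
  ball containing it.
\<close>

lemma steiner_subset_cball:
  fixes u :: "'a::euclidean_space"
  assumes u: "norm u = 1" and S: "S \<in> sets borel" "S \<subseteq> cball 0 R"
  shows "steiner u S \<subseteq> cball 0 R"
proof
  fix x assume x: "x \<in> steiner u S"
  have uu: "u \<bullet> u = 1" using u by (simp add: dot_square_norm)
  define s where "s = x \<bullet> u"
  define y where "y = x - s *\<^sub>R u"
  have yu: "y \<bullet> u = 0" by (simp add: y_def s_def inner_diff_left uu)
  have x_eq: "x = y + s *\<^sub>R u" by (simp add: y_def)
  have sq: "(norm (y + t *\<^sub>R u))\<^sup>2 = (norm y)\<^sup>2 + t\<^sup>2" for t
    unfolding power2_norm_eq_inner using yu uu
    by (simp add: inner_add_left inner_add_right inner_commute power2_eq_square)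
  let ?m = "measure lborel (chord u S y)"
  have m: "2 * \<bar>s\<bar> < ?m"
    using x measure_chord_shift[OF S(1), of u y s]
    by (simp only: x_eq[symmetric] mem_steiner s_def[symmetric])
  have chord: "\<bar>t\<bar> \<le> sqrt (R\<^sup>2 - (norm y)\<^sup>2)" "norm y \<le> R" "0 \<le> R" if "t \<in> chord u S y" for t
  proof -
    have le: "norm (y + t *\<^sub>R u) \<le> R" using that S by (auto simp: chord_def)
    then show "0 \<le> R" using norm_ge_zero order_trans by blast
    have "(norm y)\<^sup>2 + t\<^sup>2 \<le> R\<^sup>2"
      using power_mono[OF le, of 2] by (simp add: sq)
    then show "\<bar>t\<bar> \<le> sqrt (R\<^sup>2 - (norm y)\<^sup>2)" 
      by (metis add_le_cancel_left diff_add_cancel le_diff_eq add.commute real_sqrt_abs real_sqrt_le_iff)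
    show "norm y \<le> R" 
      using \<open>(norm y)\<^sup>2 + t\<^sup>2 \<le> R\<^sup>2\<close> \<open>0 \<le> R\<close> 
      by (meson add_increasing2 power2_le_imp_le le_add_same_cancel1 order_trans zero_le_power2)
  qed
  have "chord u S y \<noteq> {}" using m by auto
  then obtain t0 where t0: "t0 \<in> chord u S y" by auto
  note R = chord(2,3)[OF t0]
  let ?q = "sqrt (R\<^sup>2 - (norm y)\<^sup>2)"
  have q: "0 \<le> ?q" using R by (simp add: power_mono)
  have "chord u S y \<subseteq> {- ?q .. ?q}" using chord(1) by fastforce
  then have "?m \<le> measure lborel {- ?q .. ?q}"
    by (intro measure_mono_fmeasurable) (auto simp: chord_measurable S fmeasurable_def emeasure_lborel_Icc_eq)
  then have "?m \<le> 2 * ?q" using q by simp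
  then have "\<bar>s\<bar> \<le> ?q" using m by simp
  then have "s\<^sup>2 \<le> ?q\<^sup>2" using q by (metis abs_le_square_iff abs_of_nonneg)
  also have "?q\<^sup>2 = R\<^sup>2 - (norm y)\<^sup>2" using R by (simp add: power_mono)
  finally have "(norm x)\<^sup>2 \<le> R\<^sup>2" using sq[of s] x_eq by simp
  then show "x \<in> cball 0 R" using R by (auto intro: power2_le_imp_le)
qed

text \<open>
  A bounded convex set of reals has the same interior as a segment. The open segment is all that
  is needed of it, and it exists also for the empty set.
\<close>

lemma convex_real_contains_centred_interval:
  fixes T :: "real set"
  assumes "convex T" "bounded T" "T \<in> sets borel"
  obtains a where "{t. 2 * \<bar>t - a\<bar> < measure lborel T} \<subseteq> T"
proof (cases "T = {}")
  case True
  then have "{t. 2 * \<bar>t - 0\<bar> < measure lborel T} \<subseteq> T" by auto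
  then show ?thesis using that by blast
next
  case False
  have bdd: "bdd_below T" "bdd_above T"
    using assms(2) by (auto simp: bounded_imp_bdd_below bounded_imp_bdd_above)
  have sub: "T \<subseteq> {Inf T .. Sup T}" using bdd by (auto intro: cInf_lower cSup_upper)
  have IS: "Inf T \<le> Sup T" using False sub by fastforce
  have "measure lborel T \<le> measure lborel {Inf T .. Sup T}"
    using sub assms(3) by (intro measure_mono_fmeasurable) (auto simp: fmeasurable_def emeasure_lborel_Icc_eq)
  then have m: "measure lborel T \<le> Sup T - Inf T" using IS by simp
  have "t \<in> T" if t: "Inf T < t" "t < Sup T" for t
  proof -
    obtain a where "a \<in> T" "a < t" using t(1) cInf_lessD[OF False] by blast
    moreover obtain b where "b \<in> T" "t < b" using t(2) less_cSupD[OF False] by blast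
    ultimately show ?thesis 
      using assms(1) unfolding is_interval_convex_1[symmetric] is_interval_1 by (meson less_imp_le)
  qed
  moreover have "Inf T < t \<and> t < Sup T" if "2 * \<bar>t - (Inf T + Sup T) / 2\<bar> < measure lborel T" for t
    using that m by (auto simp: abs_if field_simps split: if_splits)
  ultimately show ?thesis using that[of "(Inf T + Sup T) / 2"] by blast
qed

lemma chord_convex_bounded:
  assumes "convex S" "bounded S" "norm u = 1"
  shows "convex (chord u S x)" "bounded (chord u S x)"
proof -
  show "convex (chord u S x)"
  proof (rule convexI)
    fix s t a b :: real
    assume st: "s \<in> chord u S x" "t \<in> chord u S x" and ab: "0 \<le> a" "0 \<le> b" "a + b = 1"
    have "a *\<^sub>R (x + s *\<^sub>R u) + b *\<^sub>R (x + t *\<^sub>R u) \<in> S"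
      using st ab assms(1) by (intro convexD) (auto simp: chord_def)
    also have "a *\<^sub>R (x + s *\<^sub>R u) + b *\<^sub>R (x + t *\<^sub>R u) = (a + b) *\<^sub>R x + (a * s + b * t) *\<^sub>R u"
      by (simp add: algebra_simps)
    finally show "a *\<^sub>R s + b *\<^sub>R t \<in> chord u S x" using ab by (simp add: chord_def)
  qed
  obtain R where "S \<subseteq> cball 0 R" using assms by (auto simp: bounded_iff subset_eq)
  from chord_subset[OF this assms(3)] show "bounded (chord u S x)"
    using bounded_closed_interval bounded_subset by blast
qed

text \<open>
  Along a convex combination of base points, chords of a convex set contain the convex combination of the
  chords, so chord length is a concave function of the base point while \<open>\<bar>x \<bullet> u\<bar>\<close> is convex.
\<close>

lemma convex_steiner:
  fixes u :: "'a::euclidean_space"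
  assumes S: "convex S" "bounded S" "S \<in> sets borel" and u: "norm u = 1"
  shows "convex (steiner u S)"
proof (rule convexI)
  fix x y :: 'a and a b :: real
  assume xy: "x \<in> steiner u S" "y \<in> steiner u S" and ab: "0 \<le> a" "0 \<le> b" "a + b = 1"
  let ?z = "a *\<^sub>R x + b *\<^sub>R y"
  let ?m = "\<lambda>x. measure lborel (chord u S x)"
  have ex: "\<exists>c. {t. 2 * \<bar>t - c\<bar> < ?m x} \<subseteq> chord u S x" for x
    using convex_real_contains_centred_interval
      [OF chord_convex_bounded[OF S(1,2) u] chord_measurable[OF S(3)]] by metis
  obtain c d where c: "{t. 2 * \<bar>t - c\<bar> < ?m x} \<subseteq> chord u S x"
    and d: "{t. 2 * \<bar>t - d\<bar> < ?m y} \<subseteq> chord u S y" using ex by metis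
  have pos: "0 < ?m x" "0 < ?m y" using xy by (auto simp: steiner_def)
  let ?M = "a * ?m x + b * ?m y"
  have "0 < ?M"
  proof (cases "a = 0")
    case True then show ?thesis using ab pos by simp
  next
    case False then show ?thesis using ab pos by (simp add: add_pos_nonneg)
  qed
  have "{t. 2 * \<bar>t - (a * c + b * d)\<bar> < ?M} \<subseteq> chord u S ?z"
  proof
    fix t assume "t \<in> {t. 2 * \<bar>t - (a * c + b * d)\<bar> < ?M}"
    then have t: "2 * \<bar>t - (a * c + b * d)\<bar> < ?M" by simp
    \<comment> \<open>The relative position of \<open>t\<close> in the combined segment picks the points to combine.\<close>
    define r where "r = (t - (a * c + b * d)) / ?M"
    have r: "2 * \<bar>r\<bar> < 1" using t \<open>0 < ?M\<close> by (simp add: r_def abs_divide)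
    have "2 * \<bar>r * ?m x\<bar> < ?m x" "2 * \<bar>r * ?m y\<bar> < ?m y"
      using mult_strict_right_mono[OF r pos(1)] mult_strict_right_mono[OF r pos(2)] pos
      by (simp_all add: abs_mult)
    then have "c + r * ?m x \<in> chord u S x" "d + r * ?m y \<in> chord u S y"
      using c d by (auto simp del: abs_mult)
    then have "a *\<^sub>R (x + (c + r * ?m x) *\<^sub>R u) + b *\<^sub>R (y + (d + r * ?m y) *\<^sub>R u) \<in> S"
      using ab S(1) by (intro convexD) (auto simp: chord_def)
    also have "a *\<^sub>R (x + (c + r * ?m x) *\<^sub>R u) + b *\<^sub>R (y + (d + r * ?m y) *\<^sub>R u)
        = ?z + (a * c + b * d + r * ?M) *\<^sub>R u"
      by (simp add: algebra_simps)
    also have "a * c + b * d + r * ?M = t" using \<open>0 < ?M\<close> by (simp add: r_def)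
    finally show "t \<in> chord u S ?z" by (simp add: chord_def)
  qed
  then have "emeasure lborel {t. 2 * \<bar>t - (a * c + b * d)\<bar> < ?M} \<le> emeasure lborel (chord u S ?z)"
    by (intro emeasure_mono) (auto simp: chord_measurable S)
  then have M: "?M \<le> ?m ?z"
    using \<open>0 < ?M\<close> emeasure_chord_eq_measure[OF S(2) u] by (simp add: emeasure_centred_interval)
  have "2 * \<bar>?z \<bullet> u\<bar> \<le> a * (2 * \<bar>x \<bullet> u\<bar>) + b * (2 * \<bar>y \<bullet> u\<bar>)"
    using ab abs_triangle_ineq[of "a * (x \<bullet> u)" "b * (y \<bullet> u)"]
    by (simp add: inner_add_left abs_mult)
  also have "\<dots> < ?M"
  proof (cases "a = 0")
    case True then show ?thesis using ab xy by (simp add: steiner_def)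
  next
    case False
    then have "a * (2 * \<bar>x \<bullet> u\<bar>) < a * ?m x" "b * (2 * \<bar>y \<bullet> u\<bar>) \<le> b * ?m y"
      using ab xy by (auto simp: steiner_def intro!: mult_left_mono)
    then show ?thesis by linarith
  qed
  finally show "?z \<in> steiner u S" using M by (simp add: steiner_def)
qed

section \<open>Symmetrization decreases determinant moments\<close>

abbreviation colmat :: "('n \<Rightarrow> real ^ 'n) \<Rightarrow> real ^ 'n ^ 'n::finite" where
  "colmat v \<equiv> \<chi> i j. v j $ i"

text \<open>
  When all \<open>y i\<close> lie in the hyperplane orthogonal to \<open>u\<close>, a rotation that turns \<open>u\<close> into a
  coordinate axis puts the coefficients of \<open>u\<close> into a single row and leaves the other rows
  independent of them. Hence the determinant is linear in these coefficients, although it is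
  multi-affine in general; this linearity is what makes centred boxes optimal below.
\<close>

lemma det_colmat_line_additive:
  fixes y :: "'n::finite \<Rightarrow> real ^ 'n" and u :: "real ^ 'n"
  assumes u: "norm u = 1" and y: "\<And>i. u \<bullet> y i = 0"
  shows "det (colmat (\<lambda>i. y i + (s i + t i) *\<^sub>R u))
    = det (colmat (\<lambda>i. y i + s i *\<^sub>R u)) + det (colmat (\<lambda>i. y i + t i *\<^sub>R u))"
proof -
  obtain k A where A: "orthogonal_matrix A" and Au: "A *v axis k 1 = u"
    using orthogonal_matrix_exists_basis[OF u] by metis
  let ?B = "\<lambda>t. (\<chi> i. if i = k then (\<chi> j. t j) else (\<chi> j. column i A \<bullet> y j)) :: real ^ 'n ^ 'n"
  have colk: "column k A = u" using Au by (simp add: matrix_vector_mult_basis)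
  have ortho: "column i A \<bullet> u = 0" if "i \<noteq> k" for i
    using A that colk by (metis orthogonal_def orthogonal_matrix_orthonormal_columns)
  have prod: "transpose A ** colmat w = (\<chi> i j. column i A \<bullet> w j)" for w :: "'n \<Rightarrow> real ^ 'n"
    by (simp add: matrix_matrix_mult_def transpose_def column_def inner_vec_def vec_eq_iff)
  have "det A * det (colmat (\<lambda>i. y i + t i *\<^sub>R u)) = det (?B t)" for t
  proof -
    have "transpose A ** colmat (\<lambda>i. y i + t i *\<^sub>R u) = ?B t"
    proof -
      have "column i A \<bullet> (y j + t j *\<^sub>R u) = (if i = k then t j else column i A \<bullet> y j)" for i j
        using u y[of j] ortho[of i] colk by (auto simp: inner_add_right dot_square_norm)
      then show ?thesis unfolding prod by (simp add: vec_eq_iff)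
    qed
    from arg_cong[OF this, of det] show ?thesis by (simp add: det_mul)
  qed
  moreover have "det (?B (\<lambda>i. s i + t i)) = det (?B s) + det (?B t)"
  proof -
    have "?B (\<lambda>i. s i + t i)
        = (\<chi> i. if i = k then (\<chi> j. s j) + (\<chi> j. t j) else (\<chi> j. column i A \<bullet> y j))"
      by (simp add: vec_eq_iff)
    then show ?thesis
      using det_row_add[of k "\<lambda>_. \<chi> j. s j" "\<lambda>_. \<chi> j. t j" "\<lambda>i. \<chi> j. column i A \<bullet> y j"] by simp
  qed
  ultimately have "det A * det (colmat (\<lambda>i. y i + (s i + t i) *\<^sub>R u))
    = det A * (det (colmat (\<lambda>i. y i + s i *\<^sub>R u)) + det (colmat (\<lambda>i. y i + t i *\<^sub>R u)))"
    by (simp add: distrib_left)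
  moreover have "det A \<noteq> 0" using det_orthogonal_matrix[OF A] by auto
  ultimately show ?thesis by simp
qed

lemma convex_on_abs_powr:
  assumes "1 \<le> p"
  shows "convex_on UNIV (\<lambda>x::real. \<bar>x\<bar> powr p)"
proof (intro convex_onI)
  fix t x y :: real
  assume t: "0 < t" "t < 1"
  have shrink: "\<bar>c * z\<bar> powr p \<le> c * \<bar>z\<bar> powr p" if "0 < c" "c < 1" for c z :: real
  proof -
    have "c powr p \<le> c powr 1" using that assms by (intro powr_mono') auto
    then show ?thesis using that by (simp add: abs_mult powr_mult mult_right_mono)
  qed
  show "\<bar>(1 - t) *\<^sub>R x + t *\<^sub>R y\<bar> powr p \<le> (1 - t) * \<bar>x\<bar> powr p + t * \<bar>y\<bar> powr p"
  proof (cases "x = 0 \<or> y = 0")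
    case True
    then show ?thesis using shrink[of t y] shrink[of "1 - t" x] t by auto
  next
    case False
    have "\<bar>(1 - t) *\<^sub>R x + t *\<^sub>R y\<bar> \<le> (1 - t) * \<bar>x\<bar> + t * \<bar>y\<bar>"
      using abs_triangle_ineq[of "(1 - t) * x" "t * y"] t by (simp add: abs_mult)
    then have "\<bar>(1 - t) *\<^sub>R x + t *\<^sub>R y\<bar> powr p \<le> ((1 - t) * \<bar>x\<bar> + t * \<bar>y\<bar>) powr p"
      using assms by (intro powr_mono2) auto
    also have "\<dots> \<le> (1 - t) * \<bar>x\<bar> powr p + t * \<bar>y\<bar> powr p"
      using convex_onD[OF powr_convex[OF assms], of t "\<bar>x\<bar>" "\<bar>y\<bar>"] False t by simp
    finally show ?thesis .
  qed
qed simp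

lemma powr_midpoint_le:
  fixes a b p :: real
  assumes "1 \<le> p"
  shows "2 * \<bar>a\<bar> powr p \<le> \<bar>a + b\<bar> powr p + \<bar>a - b\<bar> powr p"
  using convex_onD[OF convex_on_abs_powr[OF assms], of "1/2" "a + b" "a - b"]
  by (simp add: field_simps)

lemma prod_mono_ennreal:
  fixes f g :: "'i \<Rightarrow> ennreal"
  assumes "\<And>i. i \<in> A \<Longrightarrow> f i \<le> g i"
  shows "prod f A \<le> prod g A"
  using assms by (induction A rule: infinite_finite_induct) (auto intro: mult_mono)

lemma colmat_det_measurable [measurable]:
  "(\<lambda>x. det (colmat x)) \<in> borel_measurable (Pi\<^sub>M UNIV (\<lambda>_. lborel :: (real ^ 'n::finite) measure))"
proof -
  have [measurable]: "(\<lambda>x. x j $ i) \<in> borel_measurable (Pi\<^sub>M UNIV (\<lambda>_. lborel :: (real ^ 'n) measure))"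
    for i j :: 'n
    by (rule measurable_compose[OF measurable_component_singleton, of j])
       (auto intro!: borel_measurable_continuous_onI continuous_intros)
  show ?thesis unfolding det_def by simp
qed

lemma abs_det_measurable [measurable]:
  "abs_det \<in> borel_measurable (Pi\<^sub>M UNIV (\<lambda>_. lborel :: (real ^ 'n::finite) measure))"
  unfolding abs_det_def[abs_def] by measurable

lemma measurable_tuple_shift:
  "(\<lambda>t i. t i + c i) \<in> measurable lborel_tuples (lborel_tuples :: ('i::finite \<Rightarrow> 'a::euclidean_space) measure)"
  by (rule measurable_PiM_single') (auto simp: space_PiM)

text \<open>
  Reflecting the box shows that the shifts \<open>b\<close> and \<open>- b\<close> give the same integral, and by convexity
  the mean of the two integrands dominates the unshifted one.
\<close>

lemma centred_box_integral_least:
  fixes \<phi> :: "('n::finite \<Rightarrow> real) \<Rightarrow> real" and b :: "'n \<Rightarrow> real"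
  assumes [measurable]: "\<phi> \<in> borel_measurable lborel_tuples"
    and add: "\<And>s t. \<phi> (\<lambda>i. s i + t i) = \<phi> s + \<phi> t" and p: "1 \<le> p"
  shows "(\<integral>\<^sup>+t. (\<Prod>i\<in>UNIV. indicator {t. 2 * \<bar>t\<bar> < m i} (t i)) * ennreal (\<bar>\<phi> t\<bar> powr p) \<partial>lborel_tuples)
    \<le> (\<integral>\<^sup>+t. (\<Prod>i\<in>UNIV. indicator {t. 2 * \<bar>t\<bar> < m i} (t i)) * ennreal (\<bar>\<phi> (\<lambda>i. t i + b i)\<bar> powr p) \<partial>lborel_tuples)"
    (is "?J \<le> _")
proof -
  let ?I = "\<lambda>b. \<integral>\<^sup>+t. (\<Prod>i\<in>UNIV. indicator {t. 2 * \<bar>t\<bar> < m i} (t i)) *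
    ennreal (\<bar>\<phi> (\<lambda>i. t i + b i)\<bar> powr p) \<partial>lborel_tuples"
  let ?w = "\<lambda>t. \<Prod>i\<in>UNIV. indicator {t. 2 * \<bar>t\<bar> < m i} (t i) :: ennreal"
  have shift[measurable]: "(\<lambda>t. \<phi> (\<lambda>i. t i + c i)) \<in> borel_measurable lborel_tuples" for c
    by (rule measurable_compose[OF measurable_tuple_shift]) measurable
  have zero: "\<phi> (\<lambda>i. 0) = 0" using add[of "\<lambda>_. 0" "\<lambda>_. 0"] by simp
  have minus: "\<phi> (\<lambda>i. - t i) = - \<phi> t" for t
    using add[of t "\<lambda>i. - t i"] zero by simp
  have "?I b = (\<integral>\<^sup>+t. ?w (\<lambda>i. - t i) * ennreal (\<bar>\<phi> (\<lambda>i. - t i + b i)\<bar> powr p) \<partial>lborel_tuples)"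
    by (rule nn_integral_lborel_tuples_uminus[symmetric]) measurable
  also have "\<dots> = ?I (\<lambda>i. - b i)"
  proof (rule nn_integral_cong)
    fix t :: "'n \<Rightarrow> real"
    have "\<phi> (\<lambda>i. - t i + b i) = - \<phi> (\<lambda>i. t i + - b i)"
      using minus[of "\<lambda>i. t i + - b i"] by simp
    then show "?w (\<lambda>i. - t i) * ennreal (\<bar>\<phi> (\<lambda>i. - t i + b i)\<bar> powr p)
        = ?w t * ennreal (\<bar>\<phi> (\<lambda>i. t i + - b i)\<bar> powr p)"
      by (simp add: indicator_def)
  qed
  finally have reflect: "?I b = ?I (\<lambda>i. - b i)" .
  have "2 * ?J = (\<integral>\<^sup>+t. 2 * (?w t * ennreal (\<bar>\<phi> t\<bar> powr p)) \<partial>lborel_tuples)"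
    by (rule nn_integral_cmult[symmetric]) measurable
  also have "\<dots> \<le> (\<integral>\<^sup>+t. ?w t * ennreal (\<bar>\<phi> (\<lambda>i. t i + b i)\<bar> powr p)
      + ?w t * ennreal (\<bar>\<phi> (\<lambda>i. t i + - b i)\<bar> powr p) \<partial>lborel_tuples)"
  proof (rule nn_integral_mono)
    fix t :: "'n \<Rightarrow> real"
    have "2 * \<bar>\<phi> t\<bar> powr p \<le> \<bar>\<phi> t + \<phi> b\<bar> powr p + \<bar>\<phi> t + - \<phi> b\<bar> powr p"
      using powr_midpoint_le[OF p, of "\<phi> t" "\<phi> b"] by simp
    also have "\<phi> t + \<phi> b = \<phi> (\<lambda>i. t i + b i)" by (simp add: add)
    also have "\<phi> t + - \<phi> b = \<phi> (\<lambda>i. t i + - b i)" using add[of t "\<lambda>i. - b i"] minus[of b] by simp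
    finally have "2 * ennreal (\<bar>\<phi> t\<bar> powr p)
        \<le> ennreal (\<bar>\<phi> (\<lambda>i. t i + b i)\<bar> powr p) + ennreal (\<bar>\<phi> (\<lambda>i. t i + - b i)\<bar> powr p)"
      by (metis ennreal_leI ennreal_mult' ennreal_numeral ennreal_plus powr_ge_zero zero_le_numeral)
    then have "?w t * (2 * ennreal (\<bar>\<phi> t\<bar> powr p))
        \<le> ?w t * (ennreal (\<bar>\<phi> (\<lambda>i. t i + b i)\<bar> powr p) + ennreal (\<bar>\<phi> (\<lambda>i. t i + - b i)\<bar> powr p))"
      by (rule mult_left_mono) simp
    then show "2 * (?w t * ennreal (\<bar>\<phi> t\<bar> powr p))
        \<le> ?w t * ennreal (\<bar>\<phi> (\<lambda>i. t i + b i)\<bar> powr p) + ?w t * ennreal (\<bar>\<phi> (\<lambda>i. t i + - b i)\<bar> powr p)"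
      by (simp add: distrib_left mult.left_commute)
  qed
  also have "\<dots> = ?I b + ?I (\<lambda>i. - b i)"
    by (rule nn_integral_add) measurable
  also have "\<dots> = 2 * ?I b" by (simp only: reflect[symmetric] mult_2[of "?I b"])
  finally show ?thesis
    by (subst (asm) ennreal_mult_le_mult_iff) auto
qed

definition det_moment :: "real \<Rightarrow> ('n::finite \<Rightarrow> (real ^ 'n) set) \<Rightarrow> ennreal" where
  "det_moment p S =
     (\<integral>\<^sup>+x. (\<Prod>i\<in>UNIV. indicator (S i) (x i)) * ennreal (abs_det x powr p) \<partial>lborel_tuples)"

text \<open>
  On a fixed family of parallel lines, symmetrizing recentres the chords without changing their
  lengths, and the determinant is a linear function of the positions relative to the hyperplane.
  The centred position has the least integral.
\<close>

theorem det_moment_steiner_le: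
  fixes S :: "'n::finite \<Rightarrow> (real ^ 'n) set"
  assumes S: "\<And>i. convex (S i)" "\<And>i. bounded (S i)" "\<And>i. S i \<in> sets borel"
    and u: "norm u = 1" and p: "1 \<le> p"
  shows "det_moment p (\<lambda>i. steiner u (S i)) \<le> det_moment p S"
proof -
  note S(3)[measurable]
  define G where "G T x = (\<integral>\<^sup>+t. (\<Prod>i\<in>UNIV. indicator (chord u (T i) (x i)) (t i)) *
      ennreal (abs_det (\<lambda>i. x i + t i *\<^sub>R u) powr p) \<partial>lborel_tuples)"
    for T :: "'n \<Rightarrow> (real ^ 'n) set" and x
  have by_chords: "det_moment p T =
    (\<integral>\<^sup>+x. (\<Prod>i\<in>UNIV. indicator (slab u) (x i)) * G T x \<partial>lborel_tuples)"
    if [measurable]: "\<And>i. T i \<in> sets borel" for T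
  proof -
    have ind: "indicator (T i) (x + t *\<^sub>R u) = (indicator (chord u (T i) x) t :: ennreal)" for i x t
      by (simp add: indicator_def mem_chord)
    show ?thesis
      unfolding det_moment_def G_def by (subst nn_integral_tuples_by_chords[OF _ u]) (auto simp: ind)
  qed
  have "G (\<lambda>i. steiner u (S i)) x \<le> G S x" for x
  proof -
    define s where "s i = x i \<bullet> u" for i
    define m where "m i = measure lborel (chord u (S i) (x i))" for i
    define \<phi> where "\<phi> t = det (colmat (\<lambda>i. (x i - s i *\<^sub>R u) + t i *\<^sub>R u))" for t
    have line[measurable]: "(\<lambda>t i. (c i :: real ^ 'n) + (t i :: real) *\<^sub>R u) \<in> measurable lborel_tuples lborel_tuples" for c
      by (rule measurable_PiM_single') (auto simp: space_PiM)
    have \<phi>_meas[measurable]: "\<phi> \<in> borel_measurable lborel_tuples"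
      unfolding \<phi>_def[abs_def] by (rule measurable_compose[OF line colmat_det_measurable])
    have shift[measurable]: "(\<lambda>t. \<phi> (\<lambda>i. t i + c i)) \<in> borel_measurable lborel_tuples" for c
      by (rule measurable_compose[OF measurable_tuple_shift]) measurable
    have \<phi>_add: "\<phi> (\<lambda>i. r i + t i) = \<phi> r + \<phi> t" for r t
      unfolding \<phi>_def
    proof (rule det_colmat_line_additive[OF u])
      show "u \<bullet> (x i - s i *\<^sub>R u) = 0" for i
        using u by (simp add: s_def inner_diff_right inner_commute[of u] dot_square_norm)
    qed
    have det: "abs_det (\<lambda>i. x i + t i *\<^sub>R u) = \<bar>\<phi> (\<lambda>i. t i + s i)\<bar>" for t
      by (simp add: abs_det_def \<phi>_def algebra_simps)
    have centre: "(\<integral>\<^sup>+t. (\<Prod>i\<in>UNIV. indicator {t. 2 * \<bar>t - c i\<bar> < m i} (t i)) *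
        ennreal (abs_det (\<lambda>i. x i + t i *\<^sub>R u) powr p) \<partial>lborel_tuples)
      = (\<integral>\<^sup>+t. (\<Prod>i\<in>UNIV. indicator {t. 2 * \<bar>t\<bar> < m i} (t i)) *
        ennreal (\<bar>\<phi> (\<lambda>i. t i + (c i + s i))\<bar> powr p) \<partial>lborel_tuples)" for c
    proof -
      let ?f = "\<lambda>t. (\<Prod>i\<in>UNIV. indicator {t. 2 * \<bar>t - c i\<bar> < m i} (t i)) *
        ennreal (\<bar>\<phi> (\<lambda>i. t i + s i)\<bar> powr p)"
      have "?f \<in> borel_measurable lborel_tuples" by measurable
      from nn_integral_lborel_tuples_translate[OF this, of c]
      show ?thesis by (simp add: det indicator_def add.assoc)
    qed
    have "\<exists>a. {t. 2 * \<bar>t - a\<bar> < m i} \<subseteq> chord u (S i) (x i)" for i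
      using convex_real_contains_centred_interval
        [OF chord_convex_bounded[OF S(1,2) u] chord_measurable[OF S(3)]] unfolding m_def by metis
    then obtain a where a: "\<And>i. {t. 2 * \<bar>t - a i\<bar> < m i} \<subseteq> chord u (S i) (x i)" by metis
    have "G (\<lambda>i. steiner u (S i)) x
      = (\<integral>\<^sup>+t. (\<Prod>i\<in>UNIV. indicator {t. 2 * \<bar>t\<bar> < m i} (t i)) * ennreal (\<bar>\<phi> t\<bar> powr p) \<partial>lborel_tuples)"
      unfolding G_def chord_steiner[OF S(3) u] m_def[symmetric] s_def[symmetric] centre by simp
    also have "\<dots> \<le> (\<integral>\<^sup>+t. (\<Prod>i\<in>UNIV. indicator {t. 2 * \<bar>t\<bar> < m i} (t i)) *
        ennreal (\<bar>\<phi> (\<lambda>i. t i + (a i + s i))\<bar> powr p) \<partial>lborel_tuples)"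
      using centred_box_integral_least[where \<phi> = \<phi> and b = "\<lambda>i. a i + s i" and m = m and p = p]
        \<phi>_meas \<phi>_add p by simp
    also have "\<dots> \<le> G S x"
      unfolding centre[symmetric] G_def using a
      by (intro nn_integral_mono mult_right_mono prod_mono_ennreal) (auto simp: indicator_def)
    finally show ?thesis .
  qed
  then have "(\<integral>\<^sup>+x. (\<Prod>i\<in>UNIV. indicator (slab u) (x i)) * G (\<lambda>i. steiner u (S i)) x \<partial>lborel_tuples)
    \<le> (\<integral>\<^sup>+x. (\<Prod>i\<in>UNIV. indicator (slab u) (x i)) * G S x \<partial>lborel_tuples)"
    by (intro nn_integral_mono mult_left_mono) auto
  then show ?thesis
    by (simp only: by_chords[of "\<lambda>i. steiner u (S i)", OF steiner_borel[OF S(3)]] by_chords[of S, OF S(3)])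
qed

section \<open>Approaching balls by symmetrization\<close>

text \<open>
  A point of \<open>S - B\<close> that the translation by \<open>c *\<^sub>R u\<close> carries into \<open>B - S\<close> stays on its line. On
  each line the common part of \<open>S\<close> and \<open>B\<close>, together with these points or with their translates,
  fits into the chord of \<open>S\<close> and into the chord of \<open>B\<close>, hence its length is at most that of the
  shorter chord. The symmetrized chords are concentric, so they overlap in exactly that length.
\<close>

theorem steiner_overlap_gain:
  fixes S B :: "'a::euclidean_space set"
  assumes [measurable]: "S \<in> sets borel" "B \<in> sets borel"
    and bdd: "bounded S" "bounded B" and u: "norm u = 1"
  shows "emeasure lborel (S \<inter> B) + emeasure lborel {x \<in> S - B. x + c *\<^sub>R u \<in> B - S}
    \<le> emeasure lborel (steiner u S \<inter> steiner u B)"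
proof -
  define D where "D = {x \<in> S - B. x + c *\<^sub>R u \<in> B - S}"
  have D[measurable]: "D \<in> sets borel" unfolding D_def by measurable
  have [measurable]: "steiner u S \<in> sets borel" "steiner u B \<in> sets borel"
    by (simp_all add: steiner_borel)
  have le: "emeasure lborel (chord u (S \<inter> B) x) + emeasure lborel (chord u D x)
      \<le> emeasure lborel (chord u (steiner u S \<inter> steiner u B) x)" (is "?sum \<le> _") for x
  proof -
    let ?m = "\<lambda>T. measure lborel (chord u T x)"
    have "?sum = emeasure lborel (chord u (S \<inter> B) x \<union> chord u D x)"
      by (rule plus_emeasure) (auto simp: chord_measurable mem_chord D_def)
    also have "\<dots> \<le> emeasure lborel (chord u S x)"
      by (rule emeasure_mono) (auto simp: chord_measurable mem_chord D_def)
    finally have S: "?sum \<le> ennreal (?m S)"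
      by (simp add: emeasure_chord_eq_measure[OF bdd(1) u])
    define D' where "D' = chord u D (x + (- c) *\<^sub>R u)"
    have [measurable]: "D' \<in> sets borel" unfolding D'_def by (simp add: chord_measurable)
    have D': "t \<in> D' \<longleftrightarrow> x + t *\<^sub>R u - c *\<^sub>R u \<in> S - B \<and> x + t *\<^sub>R u \<in> B - S" for t
      by (simp add: D'_def mem_chord D_def algebra_simps)
    have "?sum = emeasure lborel (chord u (S \<inter> B) x) + emeasure lborel D'"
      by (simp only: D'_def emeasure_chord_shift[OF D])
    also have "\<dots> = emeasure lborel (chord u (S \<inter> B) x \<union> D')"
      by (rule plus_emeasure) (auto simp: chord_measurable D' mem_chord)
    also have "\<dots> \<le> emeasure lborel (chord u B x)"
      by (rule emeasure_mono) (auto simp: chord_measurable D' mem_chord)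
    finally have B: "?sum \<le> ennreal (?m B)"
      by (simp add: emeasure_chord_eq_measure[OF bdd(2) u])
    have "chord u (steiner u S \<inter> steiner u B) x = chord u (steiner u S) x \<inter> chord u (steiner u B) x"
      by (auto simp: chord_def)
    also have "\<dots> = {t. 2 * \<bar>t - (- (x \<bullet> u))\<bar> < min (?m S) (?m B)}"
      using assms by (subst (1 2) chord_steiner) auto
    finally have "emeasure lborel (chord u (steiner u S \<inter> steiner u B) x) = ennreal (min (?m S) (?m B))"
      by (metis emeasure_centred_interval measure_nonneg min_def)
    then show ?thesis using S B by (simp add: min_def)
  qed
  have "emeasure lborel (S \<inter> B) + emeasure lborel D
    = (\<integral>\<^sup>+x. indicator (slab u) x * emeasure lborel (chord u (S \<inter> B) x) \<partial>lborel)
      + (\<integral>\<^sup>+x. indicator (slab u) x * emeasure lborel (chord u D x) \<partial>lborel)"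
    using emeasure_by_chords[of "S \<inter> B" u] emeasure_by_chords[of D u] u by simp
  also have "\<dots> = (\<integral>\<^sup>+x. indicator (slab u) x * emeasure lborel (chord u (S \<inter> B) x)
      + indicator (slab u) x * emeasure lborel (chord u D x) \<partial>lborel)"
    by (rule nn_integral_add[symmetric])
       (auto intro!: borel_measurable_times_ennreal emeasure_chord_borel_measurable)
  also have "\<dots> \<le> (\<integral>\<^sup>+x. indicator (slab u) x * emeasure lborel (chord u (steiner u S \<inter> steiner u B) x) \<partial>lborel)"
    using le by (intro nn_integral_mono) (auto simp: distrib_left[symmetric] intro!: mult_left_mono)
  also have "\<dots> = emeasure lborel (steiner u S \<inter> steiner u B)"
    using emeasure_by_chords[of "steiner u S \<inter> steiner u B" u] u by simp
  finally show ?thesis unfolding D_def .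
qed

lemma emeasure_translate_overlap:
  fixes A C :: "'a::euclidean_space set"
  assumes [measurable]: "A \<in> sets borel" "C \<in> sets borel"
  shows "emeasure lborel {x \<in> A. x + v \<in> C} = (\<integral>\<^sup>+x. indicator A x * indicator C (x + v) \<partial>lborel)"
proof -
  have "(\<integral>\<^sup>+x. indicator A x * indicator C (x + v) \<partial>lborel)
      = (\<integral>\<^sup>+x. (indicator {x \<in> A. x + v \<in> C} x :: ennreal) \<partial>lborel)"
    by (intro nn_integral_cong) (auto simp: indicator_def)
  then show ?thesis by simp
qed

lemma translate_overlap_measurable [measurable (raw)]:
  fixes A C :: "'a::euclidean_space set"
  assumes [measurable]: "A \<in> sets borel" "C \<in> sets borel"
  shows "(\<lambda>v. emeasure lborel {x \<in> A. x + v \<in> C}) \<in> borel_measurable borel"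
proof -
  have "(\<lambda>v. \<integral>\<^sup>+x. indicator A x * indicator C (x + v) \<partial>lborel) \<in> borel_measurable (borel :: 'a measure)"
    by measurable
  then show ?thesis by (simp add: emeasure_translate_overlap)
qed

text \<open>
  The convolution identity behind the choice of a symmetrization direction: translates of \<open>A\<close>
  meet \<open>C\<close> on average in proportion to both volumes.
\<close>

lemma nn_integral_translate_overlap:
  fixes A C :: "'a::euclidean_space set"
  assumes [measurable]: "A \<in> sets borel" "C \<in> sets borel"
  shows "(\<integral>\<^sup>+v. emeasure lborel {x \<in> A. x + v \<in> C} \<partial>lborel) = emeasure lborel A * emeasure lborel C"
proof -
  have "(\<integral>\<^sup>+v. emeasure lborel {x \<in> A. x + v \<in> C} \<partial>lborel)
      = (\<integral>\<^sup>+v. (\<integral>\<^sup>+x. indicator A x * indicator C (x + v) \<partial>lborel) \<partial>lborel)"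
    by (simp add: emeasure_translate_overlap)
  also have "\<dots> = (\<integral>\<^sup>+x. (\<integral>\<^sup>+v. indicator A x * indicator C (x + v) \<partial>lborel) \<partial>lborel)"
    by (rule lborel_pair.Fubini') measurable
  also have "\<dots> = (\<integral>\<^sup>+x. indicator A x * (\<integral>\<^sup>+v. indicator C (v + x) \<partial>lborel) \<partial>lborel)"
    by (simp add: nn_integral_cmult add.commute)
  also have "\<dots> = (\<integral>\<^sup>+x. indicator A x * emeasure lborel C \<partial>lborel)"
    by (subst nn_integral_translate) simp_all
  also have "\<dots> = emeasure lborel A * emeasure lborel C"
    by (simp add: nn_integral_multc)
  finally show ?thesis .
qed

text \<open>
  Only translations by vectors of norm at most \<open>2 * R\<close> produce an overlap, so one of them does at
  least as well as half the mean over that ball. The factor two makes the comparison with the mean strict.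
\<close>

lemma exists_good_translate:
  fixes A C :: "'i::finite \<Rightarrow> 'a::euclidean_space set"
  assumes meas: "\<And>i. A i \<in> sets borel" "\<And>i. C i \<in> sets borel"
    and sub: "\<And>i. A i \<subseteq> cball 0 R" "\<And>i. C i \<subseteq> cball 0 R"
    and pos: "0 < (\<Sum>i\<in>UNIV. measure lborel (A i) * measure lborel (C i))"
  shows "\<exists>v. (\<Sum>i\<in>UNIV. measure lborel (A i) * measure lborel (C i))
      \<le> 2 * measure lborel (cball (0::'a) (2 * R)) * (\<Sum>i\<in>UNIV. measure lborel {x \<in> A i. x + v \<in> C i})"
proof (rule ccontr)
  let ?Q = "\<Sum>i\<in>UNIV. measure lborel (A i) * measure lborel (C i)"
  let ?V = "measure lborel (cball (0::'a) (2 * R))"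
  let ?g = "\<lambda>v. \<Sum>i\<in>UNIV. measure lborel {x \<in> A i. x + v \<in> C i}"
  have fin: "emeasure lborel T = ennreal (measure lborel T)" if "T \<subseteq> cball 0 R" for T :: "'a set"
  proof (rule emeasure_eq_ennreal_measure)
    have "bounded T" using that bounded_cball bounded_subset by blast
    then show "emeasure lborel T \<noteq> top" using emeasure_bounded_finite less_top by (metis infinity_ennreal_def)
  qed
  have finT: "emeasure lborel {x \<in> A i. x + v \<in> C i} = ennreal (measure lborel {x \<in> A i. x + v \<in> C i})" for i v
    using sub(1)[of i] by (intro fin) auto
  assume "\<not> ?thesis"
  then have less: "2 * ?V * ?g v < ?Q" for v by (simp add: not_le)
  have V: "0 < ?V"
  proof (rule ccontr)
    assume "\<not> 0 < ?V"
    then have V0: "?V = 0" using measure_nonneg[of lborel "cball (0::'a) (2 * R)"] by linarith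
    have "measure lborel (A i) = 0" for i
    proof -
      have "A i \<subseteq> cball 0 (2 * R)"
      proof
        fix x assume "x \<in> A i"
        then have "norm x \<le> R" using sub(1)[of i] by auto
        then have "norm x \<le> 2 * R" using norm_ge_zero[of x] by linarith
        then show "x \<in> cball 0 (2 * R)" by simp
      qed
      then have "measure lborel (A i) \<le> ?V"
        using meas by (intro measure_mono_fmeasurable) (auto intro: bounded_borel_fmeasurable)
      then show ?thesis using V0 measure_nonneg[of lborel "A i"] by linarith
    qed
    then show False using pos by simp
  qed
  have "ennreal ?Q = (\<Sum>i\<in>UNIV. emeasure lborel (A i) * emeasure lborel (C i))"
    using fin[OF sub(1)] fin[OF sub(2)] by (simp add: sum_nonneg ennreal_mult[symmetric])
  also have "\<dots> = (\<integral>\<^sup>+v. (\<Sum>i\<in>UNIV. emeasure lborel {x \<in> A i. x + v \<in> C i}) \<partial>lborel)"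
    using meas by (subst nn_integral_sum) (auto simp: nn_integral_translate_overlap translate_overlap_measurable)
  also have "\<dots> \<le> (\<integral>\<^sup>+v. ennreal (?Q / (2 * ?V)) * indicator (cball (0::'a) (2 * R)) v \<partial>lborel)"
  proof (rule nn_integral_mono)
    fix v :: 'a
    have eq: "(\<Sum>i\<in>UNIV. emeasure lborel {x \<in> A i. x + v \<in> C i}) = ennreal (?g v)"
      by (simp add: finT)
    show "(\<Sum>i\<in>UNIV. emeasure lborel {x \<in> A i. x + v \<in> C i})
        \<le> ennreal (?Q / (2 * ?V)) * indicator (cball 0 (2 * R)) v"
    proof (cases "v \<in> cball 0 (2 * R)")
      case True
      have "?g v \<le> ?Q / (2 * ?V)" using less[of v] V by (simp add: field_simps)
      then show ?thesis using True unfolding eq by (simp add: ennreal_leI)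
    next
      case False
      have empty: "{x \<in> A i. x + v \<in> C i} = {}" for i
      proof -
        have "norm v \<le> 2 * R" if "x \<in> A i" "x + v \<in> C i" for x
        proof -
          have "norm x \<le> R" "norm (x + v) \<le> R" using that sub by fastforce+
          then show ?thesis using norm_triangle_ineq4[of "x + v" x] by simp
        qed
        then show ?thesis using False by auto
      qed
      show ?thesis unfolding empty by simp
    qed
  qed
  also have "\<dots> = ennreal (?Q / (2 * ?V)) * ennreal ?V"
    by (subst nn_integral_cmult_indicator)
       (auto simp: emeasure_eq_measure2 bounded_borel_fmeasurable)
  also have "\<dots> = ennreal (?Q / 2)" using V pos by (simp add: ennreal_mult[symmetric] sum_nonneg)
  finally have "?Q \<le> ?Q / 2" using pos by (subst (asm) ennreal_le_iff) auto
  then show False using pos by simp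
qed

text \<open>
  The families reachable by symmetrization: the fixed ball of radius \<open>R\<close> bounds all of them, and
  each member keeps the volume of the ball that it is to be compared with.
\<close>

definition competitor ::
  "real \<Rightarrow> ('n::finite \<Rightarrow> real) \<Rightarrow> ('n \<Rightarrow> (real ^ 'n) set) \<Rightarrow> bool" where
  "competitor R r S \<longleftrightarrow> (\<forall>i. convex (S i) \<and> S i \<in> sets borel \<and> S i \<subseteq> cball 0 R \<and>
     emeasure lborel (S i) = emeasure lborel (cball (0 :: real ^ 'n) (r i)))"

definition deficit :: "('n::finite \<Rightarrow> real) \<Rightarrow> ('n \<Rightarrow> (real ^ 'n) set) \<Rightarrow> real" where
  "deficit r S = (\<Sum>i\<in>UNIV. measure lborel (cball 0 (r i) - S i))"

lemma competitorD:
  fixes r :: "'n::finite \<Rightarrow> real"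
  assumes "competitor R r S"
  shows "convex (S i)" "S i \<in> sets borel" "S i \<subseteq> cball 0 R" "bounded (S i)" "S i \<in> fmeasurable lborel"
    "measure lborel (S i) = measure lborel (cball (0 :: real ^ 'n) (r i))"
proof -
  show *: "convex (S i)" "S i \<in> sets borel" "S i \<subseteq> cball 0 R"
    using assms by (auto simp: competitor_def)
  show "bounded (S i)" using * bounded_cball bounded_subset by blast
  then show "S i \<in> fmeasurable lborel"
    using * by (intro bounded_borel_fmeasurable)
  show "measure lborel (S i) = measure lborel (cball (0 :: real ^ 'n) (r i))"
    using assms by (simp add: competitor_def measure_def)
qed

lemma competitor_steiner:
  fixes r :: "'n::finite \<Rightarrow> real"
  assumes "competitor R r S" "norm u = 1"
  shows "competitor R r (\<lambda>i. steiner u (S i))"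
proof -
  note S = competitorD(1-4)[OF assms(1)]
  show ?thesis unfolding competitor_def
  proof (intro allI conjI)
    fix i
    show "convex (steiner u (S i))" "steiner u (S i) \<in> sets borel"
      using S assms(2) by (simp_all add: convex_steiner steiner_borel)
    show "steiner u (S i) \<subseteq> cball 0 R" using S assms(2) by (intro steiner_subset_cball) auto
    show "emeasure lborel (steiner u (S i)) = emeasure lborel (cball (0 :: real ^ 'n) (r i))"
      using S assms by (simp add: emeasure_steiner competitor_def)
  qed
qed

lemma measure_Int_plus_Diff:
  assumes "A \<in> fmeasurable M" "B \<in> fmeasurable M"
  shows "measure M A = measure M (A \<inter> B) + measure M (A - B)"
proof -
  have "measure M (A \<inter> B \<union> A) = measure M (A \<inter> B) + measure M (A - A \<inter> B)"
    using assms by (intro measure_Un2) (auto intro: fmeasurable.Int)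
  moreover have "A \<inter> B \<union> A = A" "A - A \<inter> B = A - B" by auto
  ultimately show ?thesis by simp
qed

text \<open>
  One symmetrization lowers the deficit by a fixed multiple of its square, stated without
  division. Write \<open>B i\<close> for the ball of radius \<open>r i\<close>. The direction is that of a translation
  which carries much of the \<open>S i - B i\<close> into the \<open>B i - S i\<close> for all \<open>i\<close> at once; both sets have the same volume, so the mean overlap is a sum
  of squares and Cauchy-Schwarz applies.
\<close>

lemma deficit_steiner_gain:
  fixes r :: "'n::finite \<Rightarrow> real"
  assumes S: "competitor R r S" and r: "\<And>i. r i \<le> R" and pos: "0 < deficit r S"
  shows "\<exists>u. norm u = 1 \<and>
    deficit r (\<lambda>i. steiner u (S i)) * (2 * real CARD('n) * measure lborel (cball (0 :: real ^ 'n) (2 * R)))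
      \<le> deficit r S * (2 * real CARD('n) * measure lborel (cball (0 :: real ^ 'n) (2 * R))) - (deficit r S)\<^sup>2"
proof -
  let ?B = "\<lambda>i. cball (0 :: real ^ 'n) (r i)"
  let ?V = "measure lborel (cball (0 :: real ^ 'n) (2 * R))"
  define d where "d i = measure lborel (?B i - S i)" for i
  note S' = competitorD[OF S]
  have fB[simp]: "?B i \<in> fmeasurable lborel" for i by (rule bounded_borel_fmeasurable) auto
  have diff: "measure lborel (?B i - T) = measure lborel (?B i) - measure lborel (T \<inter> ?B i)"
    if "T \<in> fmeasurable lborel" for T i
    using measure_Int_plus_Diff[OF fB[of i] that] by (simp add: Int_commute)
  have d2: "measure lborel (S i - ?B i) = d i" for i
  proof -
    have "measure lborel (S i) = measure lborel (S i \<inter> ?B i) + measure lborel (S i - ?B i)"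
      by (rule measure_Int_plus_Diff[OF S'(5) fB])
    then show ?thesis using diff[OF S'(5), of i i] S'(6)[of i] by (simp add: d_def)
  qed
  let ?g = "\<lambda>v i. measure lborel {x \<in> S i - ?B i. x + v \<in> ?B i - S i}"
  have d_sum: "deficit r S = (\<Sum>i\<in>UNIV. d i)" by (simp add: deficit_def d_def)
  have sq: "(deficit r S)\<^sup>2 \<le> (\<Sum>i\<in>UNIV. d i * d i) * real CARD('n)"
    unfolding d_sum using sum_squared_le_sum_of_squares[of d UNIV] by (simp add: power2_eq_square)
  have Q: "0 < (\<Sum>i\<in>UNIV. d i * d i)"
  proof -
    have "0 < (\<Sum>i\<in>UNIV. d i * d i) * real CARD('n)"
      using sq zero_less_power[OF pos, of 2] by linarith
    then show ?thesis by (simp add: zero_less_mult_iff)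
  qed
  have "\<exists>v. (\<Sum>i\<in>UNIV. measure lborel (S i - ?B i) * measure lborel (?B i - S i))
      \<le> 2 * ?V * (\<Sum>i\<in>UNIV. ?g v i)"
  proof (rule exists_good_translate)
    show "?B i - S i \<subseteq> cball 0 R" for i using r[of i] by auto
    show "0 < (\<Sum>i\<in>UNIV. measure lborel (S i - ?B i) * measure lborel (?B i - S i))"
      using Q by (simp add: d2 d_def[symmetric])
  qed (use S' in auto)
  then obtain v where v: "(\<Sum>i\<in>UNIV. d i * d i) \<le> 2 * ?V * (\<Sum>i\<in>UNIV. ?g v i)"
    by (auto simp: d2 d_def[symmetric])
  have "v \<noteq> 0"
  proof
    assume "v = 0"
    have empty: "{x \<in> S i - ?B i. x + 0 \<in> ?B i - S i} = {}" for i by auto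
    have "(\<Sum>i\<in>UNIV. ?g v i) = 0" unfolding \<open>v = 0\<close> empty by simp
    from v[unfolded this] Q show False by simp
  qed
  \<comment> \<open>Symmetrize along the translation that was found to be good.\<close>
  define u where "u = v /\<^sub>R norm v"
  have u: "norm u = 1" and vu: "v = norm v *\<^sub>R u" using \<open>v \<noteq> 0\<close> by (simp_all add: u_def)
  note S'' = competitorD[OF competitor_steiner[OF S u]]
  have gain: "measure lborel (?B i - steiner u (S i)) \<le> d i - ?g v i" for i
  proof -
    have [measurable]: "S i \<in> sets borel" by (rule S')
    have D: "{x \<in> S i - ?B i. x + v \<in> ?B i - S i} \<in> fmeasurable lborel"
      by (rule fmeasurableI2[OF S'(5)[of i]]) auto
    have I: "S i \<inter> ?B i \<in> fmeasurable lborel" "steiner u (S i) \<inter> ?B i \<in> fmeasurable lborel"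
      using S'(5) S''(5) by (auto intro: fmeasurable.Int)
    have "steiner u (?B i) \<subseteq> ?B i" by (rule steiner_subset_cball[OF u]) auto
    have "emeasure lborel (S i \<inter> ?B i) + emeasure lborel {x \<in> S i - ?B i. x + v \<in> ?B i - S i}
        \<le> emeasure lborel (steiner u (S i) \<inter> steiner u (?B i))"
      using steiner_overlap_gain[of "S i" "?B i" u "norm v"] S'(4) u vu by simp
    also have "\<dots> \<le> emeasure lborel (steiner u (S i) \<inter> ?B i)"
      using \<open>steiner u (?B i) \<subseteq> ?B i\<close> S'' by (intro emeasure_mono) auto
    finally have "measure lborel (S i \<inter> ?B i) + ?g v i \<le> measure lborel (steiner u (S i) \<inter> ?B i)"
      using I D by (simp add: emeasure_eq_measure2 ennreal_plus[symmetric] del: ennreal_plus)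
    then show ?thesis
      using diff[OF S'(5), of i i] diff[OF S''(5), of i i] by (simp add: d_def)
  qed
  have "deficit r (\<lambda>i. steiner u (S i)) \<le> (\<Sum>i\<in>UNIV. d i - ?g v i)"
    unfolding deficit_def by (rule sum_mono) (rule gain)
  then have "deficit r (\<lambda>i. steiner u (S i)) \<le> deficit r S - (\<Sum>i\<in>UNIV. ?g v i)"
    by (simp only: d_sum sum_subtractf)
  then have "deficit r (\<lambda>i. steiner u (S i)) * (2 * real CARD('n) * ?V)
      \<le> (deficit r S - (\<Sum>i\<in>UNIV. ?g v i)) * (2 * real CARD('n) * ?V)"
    by (rule mult_right_mono) simp
  also have "\<dots> = deficit r S * (2 * real CARD('n) * ?V) - 2 * ?V * (\<Sum>i\<in>UNIV. ?g v i) * real CARD('n)"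
    by (simp add: algebra_simps)
  also have "\<dots> \<le> deficit r S * (2 * real CARD('n) * ?V) - (deficit r S)\<^sup>2"
    using mult_right_mono[OF v, of "real CARD('n)"] sq by linarith
  finally show ?thesis using u by blast
qed

text \<open>
  If the infimum of the deficits were positive, a competitor sufficiently close to it could be
  symmetrized to one below it. No limit of symmetrizations is taken.
\<close>

lemma competitor_close_to_balls:
  fixes r :: "'n::finite \<Rightarrow> real"
  assumes S: "competitor R r S" and r: "\<And>i. r i \<le> R" and p: "1 \<le> p" and "0 < \<delta>"
  shows "\<exists>T. competitor R r T \<and> det_moment p T \<le> det_moment p S \<and> deficit r T < \<delta>"
proof -
  let ?P = "\<lambda>T. competitor R r T \<and> det_moment p T \<le> det_moment p S"
  define X where "X = deficit r ` {T. ?P T}"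
  have "deficit r S \<in> X" using S by (auto simp: X_def)
  have nonneg: "0 \<le> d" if "d \<in> X" for d using that by (auto simp: X_def deficit_def sum_nonneg)
  then have bdd: "bdd_below X" by (auto simp: bdd_below_def)
  define e where "e = Inf X"
  define c where "c = 2 * real CARD('n) * measure lborel (cball (0 :: real ^ 'n) (2 * R))"
  have e_le: "e \<le> d" if "d \<in> X" for d unfolding e_def using that bdd by (rule cInf_lower)
  have "0 \<le> e" unfolding e_def using \<open>deficit r S \<in> X\<close> nonneg by (intro cInf_greatest) auto
  have step: "e * c \<le> d * c - d\<^sup>2" if d: "d \<in> X" "0 < d" for d
  proof -
    obtain T where T: "?P T" "d = deficit r T" using d(1) unfolding X_def by blast
    obtain u where u: "norm u = 1"
      and le: "deficit r (\<lambda>i. steiner u (T i)) * c \<le> d * c - d\<^sup>2"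
      using deficit_steiner_gain[of R r T] T r d(2) unfolding c_def by blast
    have "det_moment p (\<lambda>i. steiner u (T i)) \<le> det_moment p T"
      using competitorD[of R r T] T(1) u p by (intro det_moment_steiner_le) auto
    then have "deficit r (\<lambda>i. steiner u (T i)) \<in> X"
      using T(1) competitor_steiner[OF _ u] unfolding X_def by (blast intro: order_trans)
    then have "e * c \<le> deficit r (\<lambda>i. steiner u (T i)) * c"
      using e_le by (intro mult_right_mono) (auto simp: c_def)
    then show ?thesis using le by simp
  qed
  have "e = 0"
  proof (rule ccontr)
    assume "e \<noteq> 0"
    then have "0 < e" using \<open>0 \<le> e\<close> by simp
    have c: "0 < c"
    proof (rule ccontr)
      assume "\<not> 0 < c"
      then have "c = 0" using measure_nonneg[of lborel "cball (0 :: real ^ 'n) (2 * R)"]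
        by (simp add: c_def zero_less_mult_iff)
      then show False using step[OF \<open>deficit r S \<in> X\<close>] e_le[OF \<open>deficit r S \<in> X\<close>] \<open>0 < e\<close> by auto
    qed
    \<comment> \<open>The margin is the decrease that a deficit of at least \<open>e\<close> guarantees.\<close>
    have "e < e + e\<^sup>2 / c" using \<open>0 < e\<close> c by simp
    then obtain d where d: "d \<in> X" "d < e + e\<^sup>2 / c"
      using cInf_lessD[of X "e + e\<^sup>2 / c"] \<open>deficit r S \<in> X\<close> unfolding e_def by blast
    have "d * c < e * c + e\<^sup>2" using d(2) c by (simp add: field_simps)
    also have "\<dots> \<le> e * c + d\<^sup>2" using e_le[OF d(1)] \<open>0 < e\<close> by (simp add: power_mono)
    finally show False using step[OF d(1)] e_le[OF d(1)] \<open>0 < e\<close> by linarith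
  qed
  then obtain d where "d \<in> X" "d < \<delta>"
    using cInf_lessD[of X \<delta>] \<open>0 < \<delta>\<close> \<open>deficit r S \<in> X\<close> unfolding e_def by auto
  then show ?thesis by (auto simp: X_def)
qed

text \<open>
  A crude bound from the Leibniz formula.
\<close>

lemma abs_det_bounded:
  "\<exists>C\<ge>0. \<forall>x :: 'n::finite \<Rightarrow> real ^ 'n. (\<forall>i. norm (x i) \<le> R) \<longrightarrow> abs_det x \<le> C"
proof (cases "0 \<le> R")
  case False
  then have "\<not> norm (x :: real ^ 'n) \<le> R" for x using norm_ge_zero[of x] by linarith
  then show ?thesis by (intro exI[of _ 0]) auto
next
  case True
  let ?P = "{\<pi>. \<pi> permutes (UNIV :: 'n set)}"
  have "abs_det x \<le> (\<Sum>\<pi>\<in>?P. R ^ CARD('n))" if x: "\<forall>i. norm (x i) \<le> R" for x :: "'n \<Rightarrow> real ^ 'n"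
  proof -
    have "abs_det x \<le> (\<Sum>\<pi>\<in>?P. \<bar>of_int (sign \<pi>) * (\<Prod>i\<in>UNIV. x (\<pi> i) $ i)\<bar>)"
      unfolding abs_det_def det_def by (simp add: sum_abs)
    also have "\<dots> \<le> (\<Sum>\<pi>\<in>?P. R ^ CARD('n))"
    proof (rule sum_mono)
      fix \<pi> :: "'n \<Rightarrow> 'n"
      have "\<bar>x (\<pi> i) $ i\<bar> \<le> R" for i using component_le_norm_cart[of "x (\<pi> i)" i] x by (meson order_trans)
      then have "(\<Prod>i\<in>UNIV. \<bar>x (\<pi> i) $ i\<bar>) \<le> (\<Prod>i\<in>(UNIV :: 'n set). R)" by (intro prod_mono) auto
      then show "\<bar>of_int (sign \<pi>) * (\<Prod>i\<in>UNIV. x (\<pi> i) $ i)\<bar> \<le> R ^ CARD('n)"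
        by (simp add: abs_mult abs_prod sign_def)
    qed
    finally show ?thesis .
  qed
  moreover have "0 \<le> (\<Sum>\<pi>\<in>?P. R ^ CARD('n))" using True by (intro sum_nonneg) auto
  ultimately show ?thesis by blast
qed

section \<open>The random simplex inequality\<close>

text \<open>
  Symmetrization does not increase the moment and brings the family arbitrarily close in volume to the
  balls; on tuples of bounded sets the moment depends continuously on the sets in that sense.
\<close>

theorem det_moment_balls_le:
  fixes S :: "'n::finite \<Rightarrow> (real ^ 'n) set"
  assumes S: "\<And>i. convex (S i)" "\<And>i. S i \<in> sets borel" "\<And>i. bounded (S i)"
    and vol: "\<And>i. emeasure lborel (S i) = emeasure lborel (cball (0 :: real ^ 'n) (r i))"
    and p: "1 \<le> p"
  shows "det_moment p (\<lambda>i. cball 0 (r i)) \<le> det_moment p S"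
proof -
  let ?B = "\<lambda>i. cball (0 :: real ^ 'n) (r i)"
  obtain R where R: "\<And>i. S i \<subseteq> cball 0 R" "\<And>i. r i \<le> R"
  proof -
    have "bounded (\<Union>i. S i)" using S by (intro bounded_UN) auto
    then obtain R0 where R0: "\<And>x i. x \<in> S i \<Longrightarrow> norm x \<le> R0" by (auto simp: bounded_iff)
    have "r i \<le> max R0 (Max (range r))" for i by (simp add: le_max_iff_disj)
    moreover have "S i \<subseteq> cball 0 (max R0 (Max (range r)))" for i
      using R0 by (force simp: le_max_iff_disj)
    ultimately show ?thesis using that by blast
  qed
  have comp: "competitor R r S" using S vol R by (simp add: competitor_def)
  obtain C where C: "0 \<le> C" "\<And>x :: 'n \<Rightarrow> real ^ 'n. (\<forall>i. norm (x i) \<le> R) \<Longrightarrow> abs_det x \<le> C"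
    using abs_det_bounded[where R = R and 'n = 'n] by blast
  define V where "V = measure lborel (cball (0 :: real ^ 'n) R)"
  define K where "K = V ^ (CARD('n) - 1) * C powr p"
  have K: "0 \<le> K" by (simp add: K_def V_def)
  have approx: "det_moment p ?B \<le> det_moment p T + ennreal (deficit r T * K)"
    if T: "competitor R r T" for T
  proof -
    note T' = competitorD[OF T]
    note T'(2)[measurable]
    define h where "h i j = (if j = i then indicator (?B i - T i) else indicator (cball 0 R) :: real ^ 'n \<Rightarrow> ennreal)" for i j
    have [measurable]: "h i j \<in> borel_measurable borel" for i j
      by (auto simp: h_def intro!: borel_measurable_indicator T'(2))
    have pointwise: "(\<Prod>i\<in>UNIV. indicator (?B i) (x i)) * ennreal (abs_det x powr p)
      \<le> (\<Prod>i\<in>UNIV. indicator (T i) (x i)) * ennreal (abs_det x powr p)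
        + (\<Sum>i\<in>UNIV. (\<Prod>j\<in>UNIV. h i j (x j)) * ennreal (C powr p))" for x
    proof -
      \<comment> \<open>A tuple of points in the balls that is not in the product of the \<open>T i\<close> has a coordinate in
        some \<open>?B i - T i\<close>, and its determinant is at most \<open>C\<close>.\<close>
      consider "\<forall>i. x i \<in> T i" | i where "x i \<notin> ?B i" | i where "x i \<notin> T i" "\<forall>j. x j \<in> ?B j" by blast
      then show ?thesis
      proof cases
        case 1
        then have "(\<Prod>i\<in>UNIV. indicator (?B i) (x i)) \<le> (\<Prod>i\<in>UNIV. indicator (T i) (x i) :: ennreal)"
          by (intro prod_mono_ennreal) (auto simp: indicator_def)
        then show ?thesis by (intro add_increasing2 mult_right_mono) auto
      next
        case 2
        then have zero: "(\<Prod>i\<in>UNIV. indicator (?B i) (x i)) = (0 :: ennreal)"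
          by (intro prod_zero) (auto simp: indicator_def)
        show ?thesis unfolding zero by simp
      next
        case 3
        have R': "norm (x j) \<le> R" for j
        proof -
          have "norm (x j) \<le> r j" using 3(2) by simp
          then show ?thesis using R(2)[of j] by simp
        qed
        have "(\<Prod>j\<in>UNIV. h i j (x j)) = 1"
          using 3 R' by (intro prod.neutral) (auto simp: h_def indicator_def)
        then have "ennreal (C powr p) = (\<Prod>j\<in>UNIV. h i j (x j)) * ennreal (C powr p)" by simp
        also have "\<dots> \<le> (\<Sum>i\<in>UNIV. (\<Prod>j\<in>UNIV. h i j (x j)) * ennreal (C powr p))"
          by (rule member_le_sum) auto
        finally have le: "ennreal (C powr p) \<le> (\<Sum>i\<in>UNIV. (\<Prod>j\<in>UNIV. h i j (x j)) * ennreal (C powr p))" .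
        have "abs_det x powr p \<le> C powr p"
          using C(2)[of x] R' p by (intro powr_mono2) (auto simp: abs_det_def)
        then have "ennreal (abs_det x powr p) \<le> ennreal (C powr p)" by (rule ennreal_leI)
        note order_trans[OF this le]
        moreover have "(\<Prod>i\<in>UNIV. indicator (?B i) (x i)) = (1 :: ennreal)"
          using 3(2) by (intro prod.neutral) (auto simp: indicator_def)
        ultimately show ?thesis by (intro add_increasing) simp_all
      qed
    qed
    have "det_moment p ?B \<le> (\<integral>\<^sup>+x. (\<Prod>i\<in>UNIV. indicator (T i) (x i)) * ennreal (abs_det x powr p)
        + (\<Sum>i\<in>UNIV. (\<Prod>j\<in>UNIV. h i j (x j)) * ennreal (C powr p)) \<partial>lborel_tuples)"
      unfolding det_moment_def by (rule nn_integral_mono) (rule pointwise)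
    also have "\<dots> = det_moment p T
        + (\<Sum>i\<in>UNIV. (\<integral>\<^sup>+x. (\<Prod>j\<in>UNIV. h i j (x j)) * ennreal (C powr p) \<partial>lborel_tuples))"
      unfolding det_moment_def
      by (subst nn_integral_add, measurable, subst nn_integral_sum, measurable)
    also have "(\<Sum>i\<in>UNIV. (\<integral>\<^sup>+x. (\<Prod>j\<in>UNIV. h i j (x j)) * ennreal (C powr p) \<partial>lborel_tuples))
        = (\<Sum>i\<in>UNIV. ennreal (measure lborel (?B i - T i) * K))"
    proof (rule sum.cong[OF refl])
      fix i :: 'n
      have fm: "?B i - T i \<in> fmeasurable lborel" "cball 0 R \<in> fmeasurable (lborel :: (real ^ 'n) measure)"
        by (auto intro!: bounded_borel_fmeasurable bounded_diff)
      have "(\<integral>\<^sup>+x. (\<Prod>j\<in>UNIV. h i j (x j)) * ennreal (C powr p) \<partial>lborel_tuples)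
          = (\<Prod>j\<in>UNIV. integral\<^sup>N lborel (h i j)) * ennreal (C powr p)"
        by (subst nn_integral_multc, measurable) (subst lborel_PiM.product_nn_integral_prod, auto)
      also have "(\<Prod>j\<in>UNIV. integral\<^sup>N lborel (h i j))
          = integral\<^sup>N lborel (h i i) * (\<Prod>j\<in>UNIV - {i}. integral\<^sup>N lborel (h i j))"
        by (rule prod.remove) auto
      also have "integral\<^sup>N lborel (h i i) = ennreal (measure lborel (?B i - T i))"
        using fm by (simp add: h_def emeasure_eq_measure2)
      also have "(\<Prod>j\<in>UNIV - {i}. integral\<^sup>N lborel (h i j)) = (\<Prod>j\<in>UNIV - {i}. ennreal V)"
        using fm by (intro prod.cong) (auto simp: h_def V_def emeasure_eq_measure2)
      also have "\<dots> = ennreal (V ^ (CARD('n) - 1))"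
        by (simp add: card_Diff_singleton ennreal_power V_def)
      finally show "(\<integral>\<^sup>+x. (\<Prod>j\<in>UNIV. h i j (x j)) * ennreal (C powr p) \<partial>lborel_tuples)
          = ennreal (measure lborel (?B i - T i) * K)"
        by (simp add: K_def V_def ennreal_mult[symmetric] mult.assoc)
    qed
    also have "\<dots> = ennreal (deficit r T * K)"
      using K by (simp add: deficit_def sum_distrib_right)
    finally show ?thesis .
  qed
  show ?thesis
  proof (rule ennreal_le_epsilon)
    fix e :: real assume "0 < e"
    then have "0 < e / (K + 1)" using K by simp
    from competitor_close_to_balls[OF comp R(2) p this] obtain T where
      T: "competitor R r T" "det_moment p T \<le> det_moment p S" "deficit r T < e / (K + 1)" by blast
    have "deficit r T * K \<le> e / (K + 1) * K" using T(3) K by (intro mult_right_mono) auto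
    also have "\<dots> \<le> e" using K \<open>0 < e\<close> by (simp add: field_simps)
    finally have "ennreal (deficit r T * K) \<le> ennreal e" by (rule ennreal_leI)
    then show "det_moment p ?B \<le> det_moment p S + ennreal e"
      using approx[OF T(1)] T(2) by (meson add_mono order_trans)
  qed
qed

lemma abs_det_scale:
  "abs_det (\<lambda>i. r i *\<^sub>R x i) = (\<Prod>i\<in>UNIV. \<bar>r i\<bar>) * abs_det (x :: 'n::finite \<Rightarrow> real ^ 'n)"
proof -
  have tr: "abs_det y = \<bar>det (\<chi> i. y i)\<bar>" for y :: "'n \<Rightarrow> real ^ 'n"
  proof -
    have "colmat y = transpose (\<chi> i. y i)" by (simp add: transpose_def)
    then show ?thesis by (simp add: abs_det_def)
  qed
  have "(\<chi> i. r i *\<^sub>R x i) = (\<chi> i. r i *s x i)" by (simp add: scalar_mult_eq_scaleR)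
  then show ?thesis by (simp add: tr det_rows_mul abs_mult abs_prod)
qed

lemma emeasure_lborel_scaleR_vimage:
  fixes A :: "'a::euclidean_space set"
  assumes [measurable]: "A \<in> sets borel" and c: "0 < c"
  shows "emeasure lborel A = ennreal (c ^ DIM('a)) * emeasure lborel ((\<lambda>x. c *\<^sub>R x) -` A)"
proof -
  have "emeasure lborel A
      = emeasure (density (distr lborel borel (\<lambda>x. 0 + c *\<^sub>R x)) (\<lambda>_. \<bar>c\<bar> ^ DIM('a))) A"
    using c by (subst lborel_affine[of c 0]) auto
  also have "\<dots> = ennreal (c ^ DIM('a)) * emeasure lborel ((\<lambda>x. c *\<^sub>R x) -` A)"
    using c by (simp add: emeasure_density nn_integral_cmult emeasure_distr)
  finally show ?thesis .
qed

text \<open>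
  As for translations, it suffices to compare boxes.
\<close>

lemma nn_integral_lborel_tuples_scale:
  fixes f :: "('i::finite \<Rightarrow> 'a::euclidean_space) \<Rightarrow> ennreal"
  assumes f: "f \<in> borel_measurable lborel_tuples" and r: "\<And>i. 0 < r i"
  shows "(\<integral>\<^sup>+x. f x \<partial>lborel_tuples)
    = ennreal (\<Prod>i\<in>UNIV. r i ^ DIM('a)) * (\<integral>\<^sup>+x. f (\<lambda>i. r i *\<^sub>R x i) \<partial>lborel_tuples)"
proof -
  let ?g = "\<lambda>(x :: 'i \<Rightarrow> 'a) i. r i *\<^sub>R x i"
  let ?P = "lborel_tuples :: ('i \<Rightarrow> 'a) measure"
  let ?c = "ennreal (\<Prod>i\<in>UNIV. r i ^ DIM('a))"
  have meas: "?g \<in> measurable ?P ?P"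
    by (rule measurable_PiM_single') (auto simp: space_PiM)
  have eq: "scale_measure ?c (distr ?P ?P ?g) = ?P"
  proof (rule lborel_PiM.PiM_eqI)
    fix A :: "'i \<Rightarrow> 'a set"
    assume A: "\<And>i. i \<in> UNIV \<Longrightarrow> A i \<in> sets lborel"
    have [measurable]: "A i \<in> sets borel" for i using A[of i] by simp
    have one: "emeasure lborel (A i) = ennreal (r i ^ DIM('a)) * emeasure lborel ((\<lambda>x. r i *\<^sub>R x) -` A i)" for i
      by (rule emeasure_lborel_scaleR_vimage) (auto simp: r)
    have "emeasure (distr ?P ?P ?g) (Pi\<^sub>E UNIV A) = emeasure ?P (Pi\<^sub>E UNIV (\<lambda>i. (\<lambda>x. r i *\<^sub>R x) -` A i))"
      by (subst emeasure_distr[OF meas])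
         (auto intro!: sets_PiM_I_finite arg_cong2[where f=emeasure] simp: space_PiM PiE_iff)
    also have "\<dots> = (\<Prod>i\<in>UNIV. emeasure lborel ((\<lambda>x. r i *\<^sub>R x) -` A i))"
      by (subst lborel_PiM.emeasure_PiM) (auto simp: measurable_sets_borel[of "\<lambda>x. _ *\<^sub>R x" borel])
    finally show "emeasure (scale_measure ?c (distr ?P ?P ?g)) (Pi\<^sub>E UNIV A) = (\<Prod>i\<in>UNIV. emeasure lborel (A i))"
      using r by (simp add: one prod.distrib prod_ennreal[symmetric] less_imp_le)
  qed auto
  have "(\<integral>\<^sup>+x. f x \<partial>?P) = (\<integral>\<^sup>+x. f x \<partial>scale_measure ?c (distr ?P ?P ?g))" by (simp only: eq)
  also have "\<dots> = ?c * (\<integral>\<^sup>+x. f (?g x) \<partial>?P)"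
    using f by (simp add: nn_integral_scale_measure nn_integral_distr[OF meas])
  finally show ?thesis .
qed

lemma det_moment_balls:
  fixes r :: "'n::finite \<Rightarrow> real"
  assumes r: "\<And>i. 0 < r i"
  shows "det_moment p (\<lambda>i. cball 0 (r i))
    = ennreal (\<Prod>i\<in>UNIV. r i powr (real CARD('n) + p)) * det_moment p (\<lambda>_::'n. cball 0 1)"
proof -
  have ind: "indicator (cball 0 (r i)) (r i *\<^sub>R y) = (indicator (cball 0 1) y :: ennreal)" for i and y :: "real ^ 'n"
    using r[of i] by (simp add: indicator_def)
  have det: "ennreal (abs_det (\<lambda>i. r i *\<^sub>R x i) powr p)
      = ennreal (\<Prod>i\<in>UNIV. r i powr p) * ennreal (abs_det x powr p)" for x :: "'n \<Rightarrow> real ^ 'n"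
    using r by (simp add: abs_det_scale powr_mult prod_nonneg abs_det_def less_imp_le
        prod_powr_distrib ennreal_mult)
  have meas: "(\<lambda>x. (\<Prod>i\<in>UNIV. indicator (cball 0 (r i)) (x i)) * ennreal (abs_det x powr p))
      \<in> borel_measurable (lborel_tuples :: ('n \<Rightarrow> real ^ 'n) measure)"
    by measurable
  have "det_moment p (\<lambda>i. cball 0 (r i))
    = ennreal (\<Prod>i\<in>UNIV. r i ^ DIM(real ^ 'n)) * (\<integral>\<^sup>+x. (\<Prod>i\<in>UNIV. indicator (cball (0 :: real ^ 'n) 1) (x i)) *
        (ennreal (\<Prod>i\<in>UNIV. r i powr p) * ennreal (abs_det x powr p)) \<partial>lborel_tuples)"
    unfolding det_moment_def
    by (simp only: nn_integral_lborel_tuples_scale[where r = r, OF meas r] ind det)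
  also have "(\<integral>\<^sup>+x. (\<Prod>i\<in>UNIV. indicator (cball (0 :: real ^ 'n) 1) (x i)) *
        (ennreal (\<Prod>i\<in>UNIV. r i powr p) * ennreal (abs_det x powr p)) \<partial>lborel_tuples)
      = (\<integral>\<^sup>+x. ennreal (\<Prod>i\<in>UNIV. r i powr p) *
        ((\<Prod>i\<in>UNIV. indicator (cball (0 :: real ^ 'n) 1) (x i)) * ennreal (abs_det x powr p)) \<partial>lborel_tuples)"
    by (simp only: mult.left_commute)
  also have "\<dots> = ennreal (\<Prod>i\<in>UNIV. r i powr p) * det_moment p (\<lambda>_::'n. cball 0 1)"
    unfolding det_moment_def by (rule nn_integral_cmult) measurable
  also have "ennreal (\<Prod>i\<in>UNIV. r i ^ DIM(real ^ 'n)) *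
      (ennreal (\<Prod>i\<in>UNIV. r i powr p) * det_moment p (\<lambda>_::'n. cball 0 1))
    = ennreal ((\<Prod>i\<in>UNIV. r i ^ CARD('n)) * (\<Prod>i\<in>UNIV. r i powr p)) * det_moment p (\<lambda>_::'n. cball 0 1)"
    using r by (subst ennreal_mult) (auto simp: prod_nonneg less_imp_le mult.assoc)
  also have "(\<Prod>i\<in>UNIV. r i ^ CARD('n)) * (\<Prod>i\<in>UNIV. r i powr p) = (\<Prod>i\<in>UNIV. r i powr (real CARD('n) + p))"
    using r by (simp add: prod.distrib[symmetric] powr_add powr_realpow)
  finally show ?thesis .
qed

lemma indicator_PiE_eq_prod:
  assumes "x \<in> extensional I" "finite I"
  shows "indicator (Pi\<^sub>E I S) x = (\<Prod>i\<in>I. indicator (S i) (x i) :: 'b::{comm_semiring_1,semiring_no_zero_divisors})"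
proof (cases "x \<in> Pi\<^sub>E I S")
  case True
  then show ?thesis by (auto simp: PiE_iff indicator_def intro!: prod.neutral[symmetric])
next
  case False
  then obtain i where "i \<in> I" "x i \<notin> S i" using assms by (auto simp: PiE_iff)
  then have "(\<Prod>i\<in>I. indicator (S i) (x i) :: 'b) = 0"
    using assms by (intro prod_zero bexI[of _ i]) auto
  then show ?thesis using False by simp
qed

lemma set_integral_PiE_eq_enn2real:
  fixes S :: "'i \<Rightarrow> 'a::euclidean_space set"
  assumes "finite I" and [measurable]: "\<And>i. i \<in> I \<Longrightarrow> S i \<in> sets borel"
    and [measurable]: "f \<in> borel_measurable (Pi\<^sub>M I (\<lambda>_. lborel))" and "\<And>x. 0 \<le> f x"
  shows "(LINT x : Pi\<^sub>E I S | Pi\<^sub>M I (\<lambda>_. lborel). f x)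
    = enn2real (\<integral>\<^sup>+x. (\<Prod>i\<in>I. indicator (S i) (x i)) * ennreal (f x) \<partial>Pi\<^sub>M I (\<lambda>_. lborel))"
proof -
  have [measurable]: "Pi\<^sub>E I S \<in> sets (Pi\<^sub>M I (\<lambda>_. lborel))"
    using assms by (intro sets_PiM_I_finite) auto
  have "(LINT x : Pi\<^sub>E I S | Pi\<^sub>M I (\<lambda>_. lborel). f x)
      = enn2real (\<integral>\<^sup>+x. ennreal (indicator (Pi\<^sub>E I S) x *\<^sub>R f x) \<partial>Pi\<^sub>M I (\<lambda>_. lborel))"
    unfolding set_lebesgue_integral_def using assms(4) by (intro integral_eq_nn_integral) auto
  also have "(\<integral>\<^sup>+x. ennreal (indicator (Pi\<^sub>E I S) x *\<^sub>R f x) \<partial>Pi\<^sub>M I (\<lambda>_. lborel))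
      = (\<integral>\<^sup>+x. (\<Prod>i\<in>I. indicator (S i) (x i)) * ennreal (f x) \<partial>Pi\<^sub>M I (\<lambda>_. lborel))"
  proof (rule nn_integral_cong)
    fix x :: "'i \<Rightarrow> 'a" assume "x \<in> space (Pi\<^sub>M I (\<lambda>_. lborel))"
    then have "x \<in> extensional I" by (auto simp: space_PiM PiE_def)
    then have "(\<Prod>i\<in>I. indicator (S i) (x i)) = (indicator (Pi\<^sub>E I S) x :: ennreal)"
      using indicator_PiE_eq_prod[of x I S, where 'b = ennreal] assms(1) by simp
    then show "ennreal (indicator (Pi\<^sub>E I S) x *\<^sub>R f x) = (\<Prod>i\<in>I. indicator (S i) (x i)) * ennreal (f x)"
      by (simp add: indicator_def)
  qed
  finally show ?thesis .
qed

lemma measure_lebesgue_eq_lborel: "S \<in> sets borel \<Longrightarrow> measure lebesgue S = measure lborel S"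
  by (simp add: measure_completion)

lemma b_const_eq:
  "b_const TYPE('n::finite) p = measure lborel (cball (0 :: real ^ 'n) 1) powr (- (real CARD('n) + p)) *
    enn2real (det_moment p (\<lambda>_::'n. cball 0 1))"
  unfolding b_const_def det_moment_def
  by (subst set_integral_PiE_eq_enn2real) (auto simp: measure_lebesgue_eq_lborel)

text \<open>
  By homogeneity the moment of the balls of the given volumes is the constant \<^const>\<open>b_const\<close> times the
  product of powers of the volumes.
\<close>

theorem busemann_random_simplex:
  fixes S :: "'n::finite \<Rightarrow> (real ^ 'n) set"
  assumes S: "\<And>i. convex (S i)" "\<And>i. S i \<in> sets borel" "\<And>i. bounded (S i)" and p: "1 \<le> p"
  shows "ennreal (b_const TYPE('n) p *
      (\<Prod>i\<in>UNIV. measure lborel (S i) powr ((real CARD('n) + p) / real CARD('n)))) \<le> det_moment p S"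
proof (cases "\<exists>i. measure lborel (S i) = 0")
  case True
  then obtain i where "measure lborel (S i) = 0" by blast
  then have zero: "(\<Prod>i\<in>UNIV. measure lborel (S i) powr ((real CARD('n) + p) / real CARD('n))) = 0"
    by (intro prod_zero bexI[of _ i]) auto
  show ?thesis unfolding zero by simp
next
  case False
  let ?n = "real CARD('n)"
  define w where "w = measure lborel (cball (0 :: real ^ 'n) 1)"
  define v where "v i = measure lborel (S i)" for i
  \<comment> \<open>The ball of radius \<open>r i\<close> has volume \<open>v i\<close>.\<close>
  define r where "r i = (v i / w) powr (1 / ?n)" for i
  have w_eq: "w = unit_ball_vol ?n" unfolding w_def by (subst content_cball) auto
  have w: "0 < w" by (simp add: w_eq)
  have v: "0 < v i" for i using False by (simp add: v_def zero_less_measure_iff)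
  have r: "0 < r i" for i using v[of i] w by (simp add: r_def)
  have "emeasure lborel (S i) = emeasure lborel (cball (0 :: real ^ 'n) (r i))" for i
  proof -
    have "r i ^ CARD('n) = v i / w"
      using v[of i] w by (simp add: r_def powr_realpow[symmetric] powr_powr)
    then have "emeasure lborel (cball (0 :: real ^ 'n) (r i)) = ennreal (v i)"
      using r[of i] w by (subst emeasure_cball) (auto simp: w_eq[symmetric])
    then show ?thesis
      using bounded_borel_fmeasurable[OF S(2,3)] by (simp add: v_def emeasure_eq_measure2)
  qed
  then have le: "det_moment p (\<lambda>i. cball 0 (r i)) \<le> det_moment p S"
    by (intro det_moment_balls_le S p)
  have "r i powr (?n + p) = w powr (- ((?n + p) / ?n)) * v i powr ((?n + p) / ?n)" for i
    using v[of i] w by (simp add: r_def powr_powr powr_divide powr_minus field_simps)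
  then have "(\<Prod>i\<in>UNIV. r i powr (?n + p))
      = (\<Prod>i\<in>(UNIV :: 'n set). w powr (- ((?n + p) / ?n))) * (\<Prod>i\<in>UNIV. v i powr ((?n + p) / ?n))"
    by (simp add: prod.distrib)
  also have "(\<Prod>i\<in>(UNIV :: 'n set). w powr (- ((?n + p) / ?n))) = w powr (- (?n + p))"
    using w by (simp add: powr_realpow[symmetric] powr_powr)
  finally have prod_r: "(\<Prod>i\<in>UNIV. r i powr (?n + p))
      = w powr (- (?n + p)) * (\<Prod>i\<in>UNIV. v i powr ((?n + p) / ?n))" .
  have "ennreal (b_const TYPE('n) p * (\<Prod>i\<in>UNIV. v i powr ((?n + p) / ?n)))
      = ennreal (\<Prod>i\<in>UNIV. r i powr (?n + p)) * ennreal (enn2real (det_moment p (\<lambda>_::'n. cball 0 1)))"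
    unfolding prod_r b_const_eq w_def[symmetric]
    by (subst ennreal_mult[symmetric]) (auto simp: prod_nonneg mult_ac)
  also have "\<dots> \<le> ennreal (\<Prod>i\<in>UNIV. r i powr (?n + p)) * det_moment p (\<lambda>_::'n. cball 0 1)"
    by (intro mult_left_mono) (auto simp: ennreal_enn2real_if)
  also have "\<dots> = det_moment p (\<lambda>i. cball 0 (r i))" by (rule det_moment_balls[symmetric]) (rule r)
  also note le
  finally show ?thesis by (simp add: v_def)
qed

section \<open>Positivity and finiteness of determinant moments\<close>

lemma det_colmat_linear_in_slot:
  fixes z :: "'n::finite \<Rightarrow> real ^ 'n"
  shows "\<exists>a. \<forall>y. det (colmat (z(i := y))) = a \<bullet> y"
proof -
  let ?f = "\<lambda>y. det (colmat (z(i := y)))"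
  have rows: "?f y = det (\<chi> j. if j = i then y else z j)" for y
  proof -
    have "colmat (z(i := y)) = transpose (\<chi> j. if j = i then y else z j)"
      by (simp add: transpose_def vec_eq_iff)
    then show ?thesis by simp
  qed
  have "linear ?f"
  proof (rule linearI)
    show "?f (x + y) = ?f x + ?f y" for x y
      unfolding rows by (rule det_row_add)
    show "?f (c *\<^sub>R x) = c *\<^sub>R ?f x" for c x
      unfolding rows scalar_mult_eq_scaleR[symmetric] by (simp add: det_row_mul)
  qed
  then have "?f y = adjoint ?f 1 \<bullet> y" for y
    using adjoint_works[of ?f y 1] by (simp add: inner_commute)
  then show ?thesis by blast
qed

lemma override_on_measurable:
  assumes "I \<subseteq> (UNIV :: 'i set)"
  shows "(\<lambda>x. override_on e x I) \<in> measurable (Pi\<^sub>M I (\<lambda>_. lborel)) (lborel_tuples :: ('i \<Rightarrow> 'a::euclidean_space) measure)"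
proof (rule measurable_PiM_single')
  fix i :: 'i
  show "(\<lambda>x. override_on e x I i) \<in> measurable (Pi\<^sub>M I (\<lambda>_. lborel :: 'a measure)) lborel"
    by (cases "i \<in> I") (auto simp: override_on_def)
qed (auto simp: space_PiM)

text \<open>
  Adding the random columns one by one, each new column avoids a hyperplane: as a function of that
  column the determinant is linear, and it does not vanish at the column \<open>e i\<close> that it replaces.
\<close>

lemma AE_det_nonzero:
  fixes e :: "'n::finite \<Rightarrow> real ^ 'n"
  assumes "det (colmat e) \<noteq> 0"
  shows "AE x in Pi\<^sub>M I (\<lambda>_. lborel). det (colmat (override_on e x I)) \<noteq> 0"
proof -
  have "finite I" by simp
  then show ?thesis
  proof (induction I rule: finite_induct)
    case empty
    then show ?case using assms by simp
  next
    case (insert i I)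
    have meas[measurable]: "(\<lambda>x. det (colmat (override_on e x J))) \<in> borel_measurable (Pi\<^sub>M J (\<lambda>_. lborel))" for J
      by (rule measurable_compose[OF override_on_measurable colmat_det_measurable]) simp
    let ?N = "{x \<in> space (Pi\<^sub>M (insert i I) (\<lambda>_. lborel)). det (colmat (override_on e x (insert i I))) = 0}"
    have N[measurable]: "?N \<in> sets (Pi\<^sub>M (insert i I) (\<lambda>_. lborel))" by measurable
    have "emeasure (Pi\<^sub>M (insert i I) (\<lambda>_. lborel)) ?N
        = (\<integral>\<^sup>+x. (\<integral>\<^sup>+y. indicator ?N (x(i := y)) \<partial>lborel) \<partial>Pi\<^sub>M I (\<lambda>_. lborel))"
      using insert.hyps by (subst lborel_PiM.product_nn_integral_insert[symmetric]) auto
    also have "\<dots> = (\<integral>\<^sup>+x. 0 \<partial>Pi\<^sub>M I (\<lambda>_. lborel :: (real ^ 'n) measure))"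
    proof (rule nn_integral_cong_AE)
      show "AE x in Pi\<^sub>M I (\<lambda>_. lborel). (\<integral>\<^sup>+y. indicator ?N (x(i := y)) \<partial>lborel) = 0"
        using insert.IH
      proof eventually_elim
        case (elim x)
        let ?z = "override_on e x I"
        obtain a where a: "\<And>y. det (colmat (?z(i := y))) = a \<bullet> y"
          using det_colmat_linear_in_slot[of ?z i] by blast
        have "?z(i := e i) = ?z" using insert.hyps by (auto simp: override_on_def)
        then have "a \<bullet> e i \<noteq> 0" using elim a[of "e i"] by simp
        then have "a \<noteq> 0" by auto
        then have "negligible {y. a \<bullet> y = 0}" by (intro negligible_hyperplane) auto
        moreover have "{y. a \<bullet> y = 0} \<in> sets borel" by measurable
        ultimately have "emeasure lborel {y. a \<bullet> y = 0} = 0"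
          by (simp add: negligible_iff_null_sets null_sets_completion_iff null_setsD1)
        have over: "det (colmat (override_on e (x(i := y)) (insert i I))) = a \<bullet> y" for y
        proof -
          have "override_on e (x(i := y)) (insert i I) = ?z(i := y)" by (auto simp: override_on_def)
          then show ?thesis using a[of y] by (simp only:)
        qed
        have "(\<integral>\<^sup>+y. indicator ?N (x(i := y)) \<partial>lborel) \<le> (\<integral>\<^sup>+y. indicator {y. a \<bullet> y = 0} y \<partial>lborel)"
          by (intro nn_integral_mono) (auto simp: indicator_def over)
        also have "\<dots> = 0" using \<open>emeasure lborel {y. a \<bullet> y = 0} = 0\<close> by simp
        finally show ?case by simp
      qed
    qed
    finally have "emeasure (Pi\<^sub>M (insert i I) (\<lambda>_. lborel)) ?N = 0" by simp
    then show ?case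
      by (intro AE_I[of _ _ ?N]) (use N in auto)
  qed
qed

text \<open>
  Columns in \<open>I\<close> are integrated, the others are given by \<open>e\<close>. With \<open>I = UNIV\<close> this is
  \<^const>\<open>det_moment\<close>, with one index left out it is \<^const>\<open>simplex_moment\<close>; positivity and
  finiteness are needed for both.
\<close>

definition partial_det_moment ::
  "real \<Rightarrow> 'n::finite set \<Rightarrow> ('n \<Rightarrow> (real ^ 'n) set) \<Rightarrow> ('n \<Rightarrow> real ^ 'n) \<Rightarrow> ennreal" where
  "partial_det_moment p I S e = (\<integral>\<^sup>+x. (\<Prod>i\<in>I. indicator (S i) (x i)) *
     ennreal (abs_det (override_on e x I) powr p) \<partial>Pi\<^sub>M I (\<lambda>_. lborel))"

lemma abs_det_override_on_measurable [measurable]: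
  "(\<lambda>x. abs_det (override_on e x I)) \<in> borel_measurable (Pi\<^sub>M I (\<lambda>_. lborel))"
  by (rule measurable_compose[OF override_on_measurable abs_det_measurable]) simp

lemma partial_det_moment_pos:
  fixes e :: "'n::finite \<Rightarrow> real ^ 'n"
  assumes e: "det (colmat e) \<noteq> 0" and S[measurable]: "\<And>i. i \<in> I \<Longrightarrow> S i \<in> sets borel"
    and pos: "\<And>i. i \<in> I \<Longrightarrow> 0 < emeasure lborel (S i)"
  shows "0 < partial_det_moment p I S e"
proof (rule ccontr)
  assume "\<not> ?thesis"
  then have "partial_det_moment p I S e = 0" by (simp add: not_less)
  then have "AE x in Pi\<^sub>M I (\<lambda>_. lborel). (\<Prod>i\<in>I. indicator (S i) (x i)) *
      ennreal (abs_det (override_on e x I) powr p) = 0"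
    unfolding partial_det_moment_def by (subst (asm) nn_integral_0_iff_AE) auto
  then have "AE x in Pi\<^sub>M I (\<lambda>_. lborel). (\<Prod>i\<in>I. indicator (S i) (x i)) = (0 :: ennreal)"
    using AE_det_nonzero[OF e, of I]
  proof eventually_elim
    case (elim x)
    then have "0 < abs_det (override_on e x I) powr p" by (simp add: abs_det_def)
    then have "ennreal (abs_det (override_on e x I) powr p) \<noteq> 0" by (simp only: ennreal_eq_0_iff not_le)
    then show ?case using elim(1) by (metis mult_eq_0_iff)
  qed
  then have "(\<integral>\<^sup>+x. (\<Prod>i\<in>I. indicator (S i) (x i)) \<partial>Pi\<^sub>M I (\<lambda>_. lborel :: (real ^ 'n) measure)) = 0"
    by (subst nn_integral_0_iff_AE) auto
  moreover have "(\<integral>\<^sup>+x. (\<Prod>i\<in>I. indicator (S i) (x i)) \<partial>Pi\<^sub>M I (\<lambda>_. lborel)) = (\<Prod>i\<in>I. emeasure lborel (S i))"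
    by (subst lborel_PiM.product_nn_integral_prod) (auto intro!: prod.cong)
  ultimately obtain i where "i \<in> I" "emeasure lborel (S i) = 0" by (auto simp: prod_zero_iff)
  with pos[of i] show False by simp
qed

lemma partial_det_moment_finite:
  fixes e :: "'n::finite \<Rightarrow> real ^ 'n"
  assumes S[measurable]: "\<And>i. i \<in> I \<Longrightarrow> S i \<in> sets borel" and bdd: "\<And>i. i \<in> I \<Longrightarrow> bounded (S i)"
    and p: "1 \<le> p"
  shows "partial_det_moment p I S e < \<infinity>"
proof -
  have "bounded ((\<Union>i\<in>I. S i) \<union> range e)"
    using bdd by (auto intro: finite_imp_bounded)
  then obtain R where "\<forall>x\<in>(\<Union>i\<in>I. S i) \<union> range e. norm x \<le> R"
    unfolding bounded_iff by blast
  then have R: "\<And>i x. i \<in> I \<Longrightarrow> x \<in> S i \<Longrightarrow> norm x \<le> R" "\<And>i. norm (e i) \<le> R" by auto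
  obtain C where C: "0 \<le> C" "\<And>x :: 'n \<Rightarrow> real ^ 'n. (\<forall>i. norm (x i) \<le> R) \<Longrightarrow> abs_det x \<le> C"
    using abs_det_bounded[where R = R and 'n = 'n] by blast
  have "partial_det_moment p I S e
      \<le> (\<integral>\<^sup>+x. (\<Prod>i\<in>I. indicator (S i) (x i)) * ennreal (C powr p) \<partial>Pi\<^sub>M I (\<lambda>_. lborel))"
    unfolding partial_det_moment_def
  proof (rule nn_integral_mono)
    fix x :: "'n \<Rightarrow> real ^ 'n"
    show "(\<Prod>i\<in>I. indicator (S i) (x i)) * ennreal (abs_det (override_on e x I) powr p)
        \<le> (\<Prod>i\<in>I. indicator (S i) (x i)) * ennreal (C powr p)"
    proof (cases "\<forall>i\<in>I. x i \<in> S i")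
      case True
      then have "abs_det (override_on e x I) \<le> C"
        using R by (intro C) (auto simp: override_on_def)
      then have "abs_det (override_on e x I) powr p \<le> C powr p"
        using p by (intro powr_mono2) (auto simp: abs_det_def)
      then show ?thesis by (intro mult_left_mono ennreal_leI) auto
    next
      case False
      then obtain i where "i \<in> I" "x i \<notin> S i" by blast
      then have zero: "(\<Prod>i\<in>I. indicator (S i) (x i)) = (0 :: ennreal)"
        by (intro prod_zero bexI[of _ i]) auto
      show ?thesis unfolding zero by simp
    qed
  qed
  also have "\<dots> = (\<Prod>i\<in>I. emeasure lborel (S i)) * ennreal (C powr p)"
    by (subst nn_integral_multc, measurable) 
       (subst lborel_PiM.product_nn_integral_prod, auto intro!: arg_cong2[where f = "(*)"] prod.cong)
  also have "\<dots> < \<infinity>"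
  proof -
    have "emeasure lborel (S i) \<noteq> top" if "i \<in> I" for i
      using emeasure_bounded_finite[OF bdd[OF that]] by (simp add: less_top)
    then have "(\<Prod>i\<in>I. emeasure lborel (S i)) \<noteq> top" by (induction I rule: infinite_finite_induct) (auto simp: ennreal_mult_eq_top_iff)
    then show ?thesis by (simp add: ennreal_mult_less_top less_top)
  qed
  finally show ?thesis .
qed

lemma det_moment_eq_partial: "det_moment p S = partial_det_moment p UNIV S e"
  by (simp add: det_moment_def partial_det_moment_def override_on_def)

lemma b_const_pos:
  assumes "1 \<le> p"
  shows "0 < b_const TYPE('n::finite) p"
proof -
  let ?e = "\<lambda>i. axis i 1 :: real ^ 'n"
  have "colmat ?e = mat 1" by (simp add: mat_def axis_def vec_eq_iff)
  then have e: "det (colmat ?e) \<noteq> 0" by simp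
  have w: "0 < measure lborel (cball (0 :: real ^ 'n) 1)" by (subst content_cball) auto
  then have "0 < emeasure lborel (cball (0 :: real ^ 'n) 1)"
    using bounded_borel_fmeasurable[of "cball (0 :: real ^ 'n) 1"] by (simp add: emeasure_eq_measure2)
  then have "0 < det_moment p (\<lambda>_::'n. cball 0 1)"
    unfolding det_moment_eq_partial[where e = ?e] by (intro partial_det_moment_pos e) auto
  moreover have "det_moment p (\<lambda>_::'n. cball 0 1) < \<infinity>"
    unfolding det_moment_eq_partial[where e = ?e] using assms by (intro partial_det_moment_finite) auto
  ultimately show ?thesis
    using w unfolding b_const_eq by (simp add: enn2real_positive_iff)
qed

lemma simplex_moment_eq:
  fixes L :: "'n::finite \<Rightarrow> (real ^ 'n) set"
  assumes "\<And>i. i \<noteq> k \<Longrightarrow> L i \<in> sets borel" "\<And>i. i \<noteq> k \<Longrightarrow> bounded (L i)" "1 \<le> p"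
  shows "ennreal (simplex_moment p k L \<xi>) = partial_det_moment p (UNIV - {k}) L (\<lambda>_. \<xi>)"
proof -
  have upd: "x(k := \<xi>) = override_on (\<lambda>_. \<xi>) x (UNIV - {k})" for x :: "'n \<Rightarrow> real ^ 'n"
    by (auto simp: override_on_def)
  have "simplex_moment p k L \<xi> = enn2real (partial_det_moment p (UNIV - {k}) L (\<lambda>_. \<xi>))"
    unfolding simplex_moment_def upd partial_det_moment_def
    using assms by (subst set_integral_PiE_eq_enn2real) auto
  moreover have "partial_det_moment p (UNIV - {k}) L (\<lambda>_. \<xi>) < \<infinity>"
    using assms by (intro partial_det_moment_finite) auto
  ultimately show ?thesis by simp
qed

section \<open>Support functions of convex bodies\<close>

text \<open>
  A positively homogeneous subadditive function, positive away from the origin, is the support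
  function of exactly one convex body.
\<close>

locale sublinear_gauge =
  fixes h :: "'a::euclidean_space \<Rightarrow> real"
  assumes scale: "\<And>c x. 0 \<le> c \<Longrightarrow> h (c *\<^sub>R x) = c * h x"
    and subadd: "\<And>x y. h (x + y) \<le> h x + h y"
    and pos: "\<And>x. x \<noteq> 0 \<Longrightarrow> 0 < h x"
begin

definition wulff_shape :: "'a set" where
  "wulff_shape = {z. \<forall>x. x \<bullet> z \<le> h x}"

lemma h_zero [simp]: "h 0 = 0"
  using scale[of 0 0] by simp

lemma h_nonneg: "0 \<le> h x"
  using pos[of x] by (cases "x = 0") auto

lemma convex_h: "convex_on UNIV h"
proof (intro convex_onI)
  fix t x y assume "0 < t" "t < (1::real)"
  then show "h ((1 - t) *\<^sub>R x + t *\<^sub>R y) \<le> (1 - t) * h x + t * h y"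
    using subadd[of "(1 - t) *\<^sub>R x" "t *\<^sub>R y"] by (simp add: scale)
qed simp

lemma continuous_h: "continuous_on UNIV h"
  by (rule convex_on_continuous[OF _ convex_h]) simp

lemma norm_lower_bound: "\<exists>c>0. \<forall>x. c * norm x \<le> h x"
proof -
  obtain b :: 'a where "b \<in> Basis" using nonempty_Basis by blast
  then have "sphere 0 1 \<noteq> ({} :: 'a set)" by (auto intro!: exI[of _ b])
  then obtain x0 where x0: "x0 \<in> sphere 0 1" "\<And>x. x \<in> sphere 0 1 \<Longrightarrow> h x0 \<le> h x"
    using continuous_attains_inf[of "sphere 0 1" h] continuous_on_subset[OF continuous_h] by auto
  have "h x0 * norm x \<le> h x" for x
  proof (cases "x = 0")
    case False
    then have "h x0 \<le> h (x /\<^sub>R norm x)" by (intro x0) simp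
    then show ?thesis using False by (simp add: scale field_simps)
  qed simp
  moreover have "0 < h x0" using x0(1) by (intro pos) auto
  ultimately show ?thesis by blast
qed

lemma convex_body_wulff_shape: "convex_body wulff_shape"
proof -
  have eq: "wulff_shape = (\<Inter>x. {z. x \<bullet> z \<le> h x})" by (auto simp: wulff_shape_def)
  have conv: "convex wulff_shape" unfolding eq by (intro convex_INT convex_halfspace_le)
  have closed: "closed wulff_shape" unfolding eq by (intro closed_INT ballI closed_halfspace_le)
  have "norm z \<le> (\<Sum>b\<in>Basis. max (h b) (h (- b)))" if "z \<in> wulff_shape" for z
  proof -
    have "\<bar>z \<bullet> b\<bar> \<le> max (h b) (h (- b))" for b
    proof -
      have "b \<bullet> z \<le> h b" "(- b) \<bullet> z \<le> h (- b)" using that unfolding wulff_shape_def by blast+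
      then show ?thesis by (auto simp: inner_commute)
    qed
    then show ?thesis using norm_le_l1[of z] by (meson order_trans sum_mono)
  qed
  then have bdd: "bounded wulff_shape" by (auto simp: bounded_iff)
  obtain c where c: "0 < c" "\<And>x. c * norm x \<le> h x" using norm_lower_bound by blast
  have "ball 0 c \<subseteq> wulff_shape"
  proof
    fix z :: 'a assume z: "z \<in> ball 0 c"
    have "x \<bullet> z \<le> h x" for x
    proof -
      have "x \<bullet> z \<le> norm x * norm z" by (rule norm_cauchy_schwarz)
      also have "\<dots> \<le> norm x * c" using z by (intro mult_left_mono) auto
      also have "\<dots> \<le> h x" using c(2)[of x] by (simp add: mult.commute)
      finally show ?thesis .
    qed
    then show "z \<in> wulff_shape" by (simp add: wulff_shape_def)
  qed
  then have "0 \<in> interior wulff_shape" using c(1) by (meson centre_in_ball interiorI open_ball)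
  then show ?thesis using conv closed bdd by (auto simp: convex_body_def compact_eq_bounded_closed)
qed

text \<open>
  The point \<open>x\<close> scaled to \<open>h = 1\<close> lies outside the open unit set of \<open>h\<close>; the normal of a separating
  hyperplane, suitably scaled, is a point of the Wulff shape that touches the bound in direction \<open>x\<close>.
\<close>

lemma contact_point:
  assumes "x \<noteq> 0"
  shows "\<exists>z\<in>wulff_shape. x \<bullet> z = h x"
proof -
  let ?S = "{y. h y < 1}"
  define x0 where "x0 = x /\<^sub>R h x"
  have hx: "0 < h x" using pos[OF assms] .
  have hx0: "h x0 = 1" using hx by (simp add: x0_def scale)
  have "convex ?S"
  proof (rule convexI)
    fix y z u v assume "y \<in> ?S" "z \<in> ?S" and uv: "0 \<le> u" "0 \<le> v" "u + v = (1::real)"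
    then have "u * h y + v * h z < 1" by (intro convex_bound_lt) auto
    then show "u *\<^sub>R y + v *\<^sub>R z \<in> ?S"
      using subadd[of "u *\<^sub>R y" "v *\<^sub>R z"] uv by (simp add: scale)
  qed
  moreover have "?S \<noteq> {}" by (auto intro!: exI[of _ 0])
  moreover have "?S \<inter> {x0} = {}" using hx0 by auto
  ultimately obtain a b where ab: "a \<noteq> 0" "\<And>y. h y < 1 \<Longrightarrow> a \<bullet> y \<le> b" "b \<le> a \<bullet> x0"
    using separating_hyperplane_sets[of ?S "{x0}"] by auto
  define \<beta> where "\<beta> = a \<bullet> x0"
  have le: "a \<bullet> y \<le> \<beta> * h y" for y
  proof (cases "y = 0")
    case False
    then have hy: "0 < h y" by (rule pos)
    show ?thesis
    proof (rule field_le_mult_one_interval)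
      fix s :: real assume s: "0 < s" "s < 1"
      have "h ((s / h y) *\<^sub>R y) = s" using s hy by (simp add: scale)
      then have "a \<bullet> ((s / h y) *\<^sub>R y) \<le> b" using s by (intro ab(2)) simp
      then have "a \<bullet> ((s / h y) *\<^sub>R y) \<le> \<beta>" using ab(3) by (simp only: \<beta>_def)
      then show "s * (a \<bullet> y) \<le> \<beta> * h y" using hy by (simp add: field_simps)
    qed
  qed simp
  have "0 < a \<bullet> a" using ab(1) by simp
  then have "0 < \<beta> * h a" using le[of a] by linarith
  then have \<beta>: "0 < \<beta>" using h_nonneg[of a] by (simp add: zero_less_mult_iff)
  have "a /\<^sub>R \<beta> \<in> wulff_shape"
    using le \<beta> by (auto simp: wulff_shape_def inner_commute field_simps)
  moreover have "x \<bullet> (a /\<^sub>R \<beta>) = h x"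
  proof -
    have "x = h x *\<^sub>R x0" using hx by (simp add: x0_def)
    then have "x \<bullet> a = h x * \<beta>" by (metis \<beta>_def inner_commute inner_scaleR_left)
    then show ?thesis using \<beta> by (simp add: field_simps)
  qed
  ultimately show ?thesis by blast
qed

lemma support_fun_wulff_shape: "support_fun wulff_shape x = h x"
proof -
  have zero: "0 \<in> wulff_shape" by (simp add: wulff_shape_def h_nonneg)
  have le: "x \<bullet> z \<le> h x" if "z \<in> wulff_shape" for z using that by (simp add: wulff_shape_def)
  obtain z where z: "z \<in> wulff_shape" "x \<bullet> z = h x"
    using contact_point[of x] zero by (cases "x = 0") auto
  show ?thesis unfolding support_fun_def
  proof (rule antisym)
    show "(SUP z\<in>wulff_shape. x \<bullet> z) \<le> h x" using zero le by (intro cSUP_least) auto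
    show "h x \<le> (SUP z\<in>wulff_shape. x \<bullet> z)"
      using cSUP_upper[of z wulff_shape "(\<bullet>) x"] z le by (auto simp: bdd_above_def)
  qed
qed

end

text \<open>
  A point outside a compact convex set is cut off by a hyperplane, so the support function determines the
  set.
\<close>

lemma mem_iff_le_support_fun:
  assumes "compact K" "convex K" "K \<noteq> {}"
  shows "z \<in> K \<longleftrightarrow> (\<forall>y. y \<bullet> z \<le> support_fun K y)"
proof
  assume "z \<in> K"
  have "bdd_above ((\<bullet>) y ` K)" for y
    by (intro bounded_imp_bdd_above compact_imp_bounded compact_continuous_image assms continuous_intros)
  then show "\<forall>y. y \<bullet> z \<le> support_fun K y"
    using \<open>z \<in> K\<close> by (auto simp: support_fun_def intro!: cSUP_upper)
next
  assume le: "\<forall>y. y \<bullet> z \<le> support_fun K y"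
  show "z \<in> K"
  proof (rule ccontr)
    assume "z \<notin> K"
    then obtain a b where ab: "a \<bullet> z < b" "\<And>x. x \<in> K \<Longrightarrow> b < a \<bullet> x"
      using separating_hyperplane_closed_point[of K z] assms compact_imp_closed by blast
    have "support_fun K (- a) \<le> - b"
      unfolding support_fun_def using assms(3) ab(2) by (intro cSUP_least) (auto intro: less_imp_le)
    then show False using le[rule_format, of "- a"] ab(1) by simp
  qed
qed

lemma convex_body_eqI:
  assumes "convex_body K" "convex_body K'" "\<And>y. support_fun K y = support_fun K' y"
  shows "K = K'"
proof -
  have "K \<noteq> {}" "K' \<noteq> {}" using assms(1,2) interior_subset by (fastforce simp: convex_body_def)+
  then show ?thesis using assms mem_iff_le_support_fun[of K] mem_iff_le_support_fun[of K']
    by (auto simp: convex_body_def)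
qed

section \<open>The moment body and its polar\<close>

lemma convex_bodyD:
  fixes K :: "'a::euclidean_space set"
  assumes "convex_body K"
  shows "convex K" "K \<in> sets borel" "bounded K" "0 < emeasure lborel K"
proof -
  show "convex K" "K \<in> sets borel" "bounded K"
    using assms by (auto simp: convex_body_def compact_imp_bounded borel_compact)
  obtain x where "x \<in> interior K" using assms by (auto simp: convex_body_def)
  then obtain r where r: "0 < r" "cball x r \<subseteq> K" by (auto simp: mem_interior_cball)
  have "0 < emeasure lborel (cball x r)" using r(1) by (subst emeasure_cball) auto
  also have "\<dots> \<le> emeasure lborel K" using r \<open>K \<in> sets borel\<close> by (intro emeasure_mono) auto
  finally show "0 < emeasure lborel K" .
qed

lemma partial_det_moment_one_slot:
  fixes L :: "'n::finite \<Rightarrow> (real ^ 'n) set"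
  shows "partial_det_moment p (UNIV - {k}) L e =
    (\<integral>\<^sup>+x. (\<Prod>i\<in>UNIV - {k}. indicator (L i) (x i)) * ennreal (abs_det (x(k := e k)) powr p)
      \<partial>Pi\<^sub>M (UNIV - {k}) (\<lambda>_. lborel))"
proof -
  have "override_on e x (UNIV - {k}) = x(k := e k)" for x :: "'n \<Rightarrow> real ^ 'n"
    by (auto simp: override_on_def)
  then show ?thesis by (simp add: partial_det_moment_def)
qed

context
  fixes p :: real and k :: "'n::finite" and L :: "'n \<Rightarrow> (real ^ 'n) set"
  assumes p: "1 \<le> p" and L: "\<And>i. i \<noteq> k \<Longrightarrow> convex_body (L i)"
begin

lemma simplex_moment_nn_integral:
  "ennreal (simplex_moment p k L \<xi>) =
    (\<integral>\<^sup>+x. (\<Prod>i\<in>UNIV - {k}. indicator (L i) (x i)) * ennreal (abs_det (x(k := \<xi>)) powr p)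
      \<partial>Pi\<^sub>M (UNIV - {k}) (\<lambda>_. lborel))"
  using simplex_moment_eq[of k L p \<xi>] convex_bodyD[OF L] p by (simp add: partial_det_moment_one_slot)

lemma simplex_moment_nonneg: "0 \<le> simplex_moment p k L \<xi>"
  unfolding simplex_moment_def set_lebesgue_integral_def by (rule integral_nonneg_AE) auto

lemma slot_integrand_measurable:
  "(\<lambda>x. (\<Prod>i\<in>UNIV - {k}. indicator (L i) (x i)) * ennreal (abs_det (x(k := \<xi>)) powr p))
    \<in> borel_measurable (Pi\<^sub>M (UNIV - {k}) (\<lambda>_. lborel))"
proof -
  have [measurable]: "L i \<in> sets borel" if "i \<in> UNIV - {k}" for i using convex_bodyD(2)[OF L] that by auto
  have "override_on (\<lambda>_. \<xi>) x (UNIV - {k}) = x(k := \<xi>)" for x :: "'n \<Rightarrow> real ^ 'n"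
    by (auto simp: override_on_def)
  then have [measurable]: "(\<lambda>x. abs_det (x(k := \<xi>))) \<in> borel_measurable (Pi\<^sub>M (UNIV - {k}) (\<lambda>_. lborel))"
    using abs_det_override_on_measurable[of "\<lambda>_. \<xi>" "UNIV - {k}"] by simp
  show ?thesis by measurable
qed

lemma simplex_moment_scale:
  "simplex_moment p k L (c *\<^sub>R \<xi>) = \<bar>c\<bar> powr p * simplex_moment p k L \<xi>"
proof -
  have pointwise: "ennreal (abs_det (x(k := c *\<^sub>R \<xi>)) powr p)
      = ennreal (\<bar>c\<bar> powr p) * ennreal (abs_det (x(k := \<xi>)) powr p)" for x :: "'n \<Rightarrow> real ^ 'n"
  proof -
    obtain a where "\<And>y. det (colmat (x(k := y))) = a \<bullet> y" using det_colmat_linear_in_slot by metis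
    then have "abs_det (x(k := c *\<^sub>R \<xi>)) = \<bar>c\<bar> * abs_det (x(k := \<xi>))"
      unfolding abs_det_def by (simp only: inner_scaleR_right abs_mult)
    then show ?thesis by (simp add: powr_mult abs_det_def ennreal_mult)
  qed
  have "ennreal (simplex_moment p k L (c *\<^sub>R \<xi>))
      = ennreal (\<bar>c\<bar> powr p) * ennreal (simplex_moment p k L \<xi>)"
    unfolding simplex_moment_nn_integral nn_integral_cmult[OF slot_integrand_measurable, symmetric] pointwise
    by (simp only: mult.left_commute)
  also have "\<dots> = ennreal (\<bar>c\<bar> powr p * simplex_moment p k L \<xi>)"
    by (simp add: ennreal_mult simplex_moment_nonneg)
  finally show ?thesis by (subst (asm) ennreal_inj) (auto simp: simplex_moment_nonneg)
qed

text \<open>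
  For fixed remaining columns the determinant is linear in \<open>\<xi>\<close>, so the integrand is convex in \<open>\<xi>\<close>.
\<close>

lemma convex_simplex_moment: "convex_on UNIV (simplex_moment p k L)"
proof (intro convex_onI)
  fix t :: real and \<xi> \<eta> :: "real ^ 'n"
  assume t: "0 < t" "t < 1"
  let ?M = "simplex_moment p k L"
  let ?w = "\<lambda>x. \<Prod>i\<in>UNIV - {k}. indicator (L i) (x i) :: ennreal"
  let ?\<zeta> = "(1 - t) *\<^sub>R \<xi> + t *\<^sub>R \<eta>"
  have pointwise: "ennreal (abs_det (x(k := ?\<zeta>)) powr p) \<le> ennreal (1 - t) * ennreal (abs_det (x(k := \<xi>)) powr p)
      + ennreal t * ennreal (abs_det (x(k := \<eta>)) powr p)" for x :: "'n \<Rightarrow> real ^ 'n"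
  proof -
    obtain a where a: "\<And>y. det (colmat (x(k := y))) = a \<bullet> y" using det_colmat_linear_in_slot by metis
    have "abs_det (x(k := ?\<zeta>)) powr p \<le> (1 - t) * abs_det (x(k := \<xi>)) powr p + t * abs_det (x(k := \<eta>)) powr p"
      unfolding abs_det_def a
      using convex_onD[OF convex_on_abs_powr[OF p], of t "a \<bullet> \<xi>" "a \<bullet> \<eta>"] t by (simp add: inner_add_right)
    then have "ennreal (abs_det (x(k := ?\<zeta>)) powr p)
        \<le> ennreal ((1 - t) * abs_det (x(k := \<xi>)) powr p + t * abs_det (x(k := \<eta>)) powr p)"
      by (rule ennreal_leI)
    then show ?thesis using t by (simp add: ennreal_mult ennreal_plus)
  qed
  have "ennreal (?M ?\<zeta>) \<le> (\<integral>\<^sup>+x. ennreal (1 - t) * (?w x * ennreal (abs_det (x(k := \<xi>)) powr p))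
      + ennreal t * (?w x * ennreal (abs_det (x(k := \<eta>)) powr p)) \<partial>Pi\<^sub>M (UNIV - {k}) (\<lambda>_. lborel))"
    unfolding simplex_moment_nn_integral
  proof (rule nn_integral_mono)
    fix x :: "'n \<Rightarrow> real ^ 'n"
    show "?w x * ennreal (abs_det (x(k := ?\<zeta>)) powr p)
        \<le> ennreal (1 - t) * (?w x * ennreal (abs_det (x(k := \<xi>)) powr p))
          + ennreal t * (?w x * ennreal (abs_det (x(k := \<eta>)) powr p))"
      using mult_left_mono[OF pointwise[of x], of "?w x"] by (simp add: distrib_left mult.left_commute)
  qed
  also have "\<dots> = ennreal (1 - t) * ennreal (?M \<xi>) + ennreal t * ennreal (?M \<eta>)"
    unfolding simplex_moment_nn_integral
    by (subst nn_integral_add)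
       (auto intro!: borel_measurable_times_ennreal slot_integrand_measurable
         simp: nn_integral_cmult[OF slot_integrand_measurable])
  also have "\<dots> = ennreal ((1 - t) * ?M \<xi> + t * ?M \<eta>)"
    using t by (simp add: ennreal_mult ennreal_plus simplex_moment_nonneg)
  finally show "?M ?\<zeta> \<le> (1 - t) * ?M \<xi> + t * ?M \<eta>"
    using t by (subst (asm) ennreal_le_iff) (auto simp: simplex_moment_nonneg)
qed simp

text \<open>
  Any nonzero \<open>\<xi>\<close> is a column of an invertible matrix, namely of a multiple of an orthogonal one.
\<close>

lemma simplex_moment_pos:
  assumes "\<xi> \<noteq> 0"
  shows "0 < simplex_moment p k L \<xi>"
proof -
  obtain f where f: "orthogonal_transformation f" "f (norm \<xi> *\<^sub>R axis k (1 :: real)) = \<xi>"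
  proof (rule orthogonal_transformation_exists)
    show "norm (norm \<xi> *\<^sub>R axis k (1 :: real)) = norm \<xi>" by simp
  qed blast
  define e where "e i = norm \<xi> *\<^sub>R f (axis i 1)" for i
  have linear: "linear f" and "orthogonal_matrix (matrix f)"
    using iffD1[OF orthogonal_transformation_matrix f(1)] by (rule conjunct1 conjunct2)+
  have ek: "e k = \<xi>" using f(2) linear_cmul[OF linear] by (simp add: e_def)
  have "colmat (\<lambda>i. f (axis i 1)) = matrix f" by (simp add: matrix_def)
  moreover have "\<bar>det (matrix f)\<bar> = 1"
    using det_orthogonal_matrix[OF \<open>orthogonal_matrix (matrix f)\<close>] by auto
  ultimately have "abs_det e \<noteq> 0"
    using assms unfolding e_def abs_det_scale by (simp add: abs_det_def)
  then have "det (colmat e) \<noteq> 0" by (simp add: abs_det_def)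
  then have "0 < partial_det_moment p (UNIV - {k}) L e"
    using convex_bodyD[OF L] by (intro partial_det_moment_pos) auto
  then have "0 < ennreal (simplex_moment p k L \<xi>)"
    by (simp add: partial_det_moment_one_slot ek simplex_moment_nn_integral)
  then show ?thesis by simp
qed

text \<open>
  The \<open>p\<close>-th root of a convex \<open>p\<close>-homogeneous function is subadditive: normalize both points to value one
  and apply convexity to their mean weighted by the roots. This replaces the Minkowski
  inequality for \<open>L\<^sup>p\<close> norms.
\<close>

lemma sublinear_gauge_moment: "sublinear_gauge (\<lambda>\<xi>. simplex_moment p k L \<xi> powr (1 / p))"
proof
  let ?M = "simplex_moment p k L"
  fix \<xi> \<eta> :: "real ^ 'n"
  show scale: "?M (c *\<^sub>R \<zeta>) powr (1 / p) = c * ?M \<zeta> powr (1 / p)" if "0 \<le> c" for c \<zeta>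
    using that p by (simp add: simplex_moment_scale powr_mult powr_powr simplex_moment_nonneg)
  show pos: "0 < ?M \<zeta> powr (1 / p)" if "\<zeta> \<noteq> 0" for \<zeta>
    using simplex_moment_pos[OF that] by simp
  let ?h = "\<lambda>\<zeta>. ?M \<zeta> powr (1 / p)"
  have h_p: "?h \<zeta> powr p = ?M \<zeta>" for \<zeta>
    using p by (simp add: powr_powr simplex_moment_nonneg)
  show "?h (\<xi> + \<eta>) \<le> ?h \<xi> + ?h \<eta>"
  proof (cases "\<xi> = 0 \<or> \<eta> = 0")
    case True
    then show ?thesis by auto
  next
    case False
    define a b where "a = ?h \<xi>" and "b = ?h \<eta>"
    have ab: "0 < a" "0 < b" using False pos by (auto simp: a_def b_def)
    have unit: "?M (\<zeta> /\<^sub>R ?h \<zeta>) = 1" if "\<zeta> \<noteq> 0" for \<zeta>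
    proof -
      have "?M (\<zeta> /\<^sub>R ?h \<zeta>) = ?M \<zeta> / (?h \<zeta> powr p)"
        using pos[OF that] by (simp add: simplex_moment_scale powr_divide inverse_eq_divide)
      then show ?thesis using simplex_moment_pos[OF that] unfolding h_p by simp
    qed
    have "\<xi> + \<eta> = (a + b) *\<^sub>R ((1 - b / (a + b)) *\<^sub>R (\<xi> /\<^sub>R a) + (b / (a + b)) *\<^sub>R (\<eta> /\<^sub>R b))"
    proof -
      have "1 - b / (a + b) = a / (a + b)" using ab by (simp add: field_simps)
      then show ?thesis using ab by (simp add: scaleR_add_right)
    qed
    then have "?M (\<xi> + \<eta>) = (a + b) powr p *
        ?M ((1 - b / (a + b)) *\<^sub>R (\<xi> /\<^sub>R a) + (b / (a + b)) *\<^sub>R (\<eta> /\<^sub>R b))"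
      using ab simplex_moment_scale by simp
    also have "\<dots> \<le> (a + b) powr p * ((1 - b / (a + b)) * ?M (\<xi> /\<^sub>R a) + (b / (a + b)) * ?M (\<eta> /\<^sub>R b))"
      using ab by (intro mult_left_mono convex_onD[OF convex_simplex_moment]) auto
    also have "\<dots> = (a + b) powr p"
      using False unit by (simp add: a_def b_def)
    finally have "?h (\<xi> + \<eta>) \<le> ((a + b) powr p) powr (1 / p)"
      using p by (intro powr_mono2) (auto simp: simplex_moment_nonneg)
    also have "\<dots> = a + b" using ab p by (simp add: powr_powr)
    finally show ?thesis by (simp add: a_def b_def)
  qed
qed

text \<open>
  The moment root is a support function, which also shows that the description defining
  \<^const>\<open>N_body\<close> is met by exactly one body.
\<close>

lemma support_fun_N_body:
  "support_fun (N_body p k L) \<xi> = simplex_moment p k L \<xi> powr (1 / p)"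
proof -
  interpret sublinear_gauge "\<lambda>\<xi>. simplex_moment p k L \<xi> powr (1 / p)"
    by (rule sublinear_gauge_moment)
  have "N_body p k L = wulff_shape"
    unfolding N_body_def
  proof (rule the_equality)
    show "convex_body wulff_shape \<and>
        (\<forall>\<xi>. 0 \<le> support_fun wulff_shape \<xi> \<and> support_fun wulff_shape \<xi> powr p = simplex_moment p k L \<xi>)"
      using p by (simp add: convex_body_wulff_shape support_fun_wulff_shape powr_powr simplex_moment_nonneg)
  next
    fix N assume N: "convex_body N \<and>
        (\<forall>\<xi>. 0 \<le> support_fun N \<xi> \<and> support_fun N \<xi> powr p = simplex_moment p k L \<xi>)"
    show "N = wulff_shape"
    proof (rule convex_body_eqI)
      fix y
      from N have nonneg: "0 \<le> support_fun N y" and eq: "support_fun N y powr p = simplex_moment p k L y"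
        by auto
      have "support_fun N y = (support_fun N y powr p) powr (1 / p)"
        using nonneg p by (simp add: powr_powr)
      then show "support_fun N y = support_fun wulff_shape y"
        by (simp only: eq support_fun_wulff_shape)
    qed (use N convex_body_wulff_shape in auto)
  qed
  then show ?thesis by (simp add: support_fun_wulff_shape)
qed

lemma polar_N_body: "polar_body (N_body p k L) = {\<xi>. simplex_moment p k L \<xi> \<le> 1}"
proof -
  have "simplex_moment p k L \<xi> powr (1 / p) \<le> 1 \<longleftrightarrow> simplex_moment p k L \<xi> \<le> 1" for \<xi>
  proof
    assume "simplex_moment p k L \<xi> powr (1 / p) \<le> 1"
    then have "(simplex_moment p k L \<xi> powr (1 / p)) powr p \<le> 1 powr p"
      using p by (intro powr_mono2) auto
    then show "simplex_moment p k L \<xi> \<le> 1" using p by (simp add: powr_powr simplex_moment_nonneg)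
  next
    assume "simplex_moment p k L \<xi> \<le> 1"
    then have "simplex_moment p k L \<xi> powr (1 / p) \<le> 1 powr (1 / p)"
      using p by (intro powr_mono2) (auto simp: simplex_moment_nonneg)
    then show "simplex_moment p k L \<xi> powr (1 / p) \<le> 1" by simp
  qed
  then show ?thesis by (simp add: polar_body_def support_fun_N_body)
qed

lemma continuous_simplex_moment: "continuous_on UNIV (simplex_moment p k L)"
  by (rule convex_on_continuous[OF _ convex_simplex_moment]) simp

lemma unit_sublevel_set:
  "convex {\<xi>. simplex_moment p k L \<xi> \<le> 1}" "bounded {\<xi>. simplex_moment p k L \<xi> \<le> 1}"
  "{\<xi>. simplex_moment p k L \<xi> \<le> 1} \<in> sets borel"
proof -
  interpret sublinear_gauge "\<lambda>\<xi>. simplex_moment p k L \<xi> powr (1 / p)"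
    by (rule sublinear_gauge_moment)
  show "convex {\<xi>. simplex_moment p k L \<xi> \<le> 1}"
  proof (rule convexI)
    fix x y u v
    assume xy: "x \<in> {\<xi>. simplex_moment p k L \<xi> \<le> 1}" "y \<in> {\<xi>. simplex_moment p k L \<xi> \<le> 1}"
      and uv: "0 \<le> u" "0 \<le> v" "u + v = (1::real)"
    have "simplex_moment p k L (u *\<^sub>R x + v *\<^sub>R y) \<le> u * simplex_moment p k L x + v * simplex_moment p k L y"
      using convex_onD[OF convex_simplex_moment, of v x y] uv by (simp add: eq_diff_eq[symmetric])
    also have "\<dots> \<le> 1" using xy uv by (intro convex_bound_le) auto
    finally show "u *\<^sub>R x + v *\<^sub>R y \<in> {\<xi>. simplex_moment p k L \<xi> \<le> 1}" by simp
  qed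
  obtain c where c: "0 < c" "\<And>x. c * norm x \<le> simplex_moment p k L x powr (1 / p)"
    using norm_lower_bound by blast
  have "norm x \<le> 1 / c" if "simplex_moment p k L x \<le> 1" for x
  proof -
    have "simplex_moment p k L x powr (1 / p) \<le> 1 powr (1 / p)"
      using that p by (intro powr_mono2) (auto simp: simplex_moment_nonneg)
    then show ?thesis using c(1) c(2)[of x] by (simp add: field_simps)
  qed
  then show "bounded {\<xi>. simplex_moment p k L \<xi> \<le> 1}" by (auto simp: bounded_iff)
  have "closed {\<xi>. simplex_moment p k L \<xi> \<le> 1}"
    by (intro closed_Collect_le continuous_simplex_moment continuous_on_const)
  then show "{\<xi>. simplex_moment p k L \<xi> \<le> 1} \<in> sets borel" by (rule borel_closed)
qed

text \<open>
  Tonelli with the free column integrated last.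
\<close>

lemma det_moment_fun_upd:
  assumes [measurable]: "P \<in> sets borel"
  shows "det_moment p (L(k := P)) = (\<integral>\<^sup>+\<xi>. indicator P \<xi> * ennreal (simplex_moment p k L \<xi>) \<partial>lborel)"
proof -
  have ins: "insert k (UNIV - {k}) = UNIV" by auto
  have meas: "(\<lambda>x. (\<Prod>i\<in>UNIV. indicator ((L(k := P)) i) (x i)) * ennreal (abs_det x powr p))
      \<in> borel_measurable (Pi\<^sub>M (insert k (UNIV - {k})) (\<lambda>_. lborel))"
  proof -
    have [measurable]: "(L(k := P)) i \<in> sets borel" for i using convex_bodyD(2)[OF L] by simp
    show ?thesis unfolding ins by measurable
  qed
  have split: "(\<Prod>i\<in>UNIV. indicator ((L(k := P)) i) ((x(k := \<xi>)) i))
      = indicator P \<xi> * (\<Prod>i\<in>UNIV - {k}. indicator (L i) (x i) :: ennreal)" for x \<xi>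
    by (subst prod.remove[of _ k]) (auto intro!: arg_cong2[where f = "(*)"] prod.cong)
  have "det_moment p (L(k := P))
      = (\<integral>\<^sup>+\<xi>. (\<integral>\<^sup>+x. (\<Prod>i\<in>UNIV. indicator ((L(k := P)) i) ((x(k := \<xi>)) i)) *
          ennreal (abs_det (x(k := \<xi>)) powr p) \<partial>Pi\<^sub>M (UNIV - {k}) (\<lambda>_. lborel)) \<partial>lborel)"
    unfolding det_moment_def
    using lborel_PiM.product_nn_integral_insert_rev[OF _ _ meas] unfolding ins by simp
  also have "\<dots> = (\<integral>\<^sup>+\<xi>. indicator P \<xi> * ennreal (simplex_moment p k L \<xi>) \<partial>lborel)"
    unfolding split mult.assoc nn_integral_cmult[OF slot_integrand_measurable] simplex_moment_nn_integral ..
  finally show ?thesis .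
qed

end

section \<open>The volume of the polar body\<close>

lemma nn_integral_powr_unit_interval:
  fixes a :: real
  assumes "0 < a"
  shows "(\<integral>\<^sup>+s. indicator {0<..1} s * ennreal (s powr a) \<partial>lborel) = ennreal (1 / (a + 1))"
proof -
  have "((\<lambda>s. s powr a) has_integral (1 / (a + 1))) {0..1}"
    using has_integral_powr_from_0[of a 1] assms by simp
  then have "(\<integral>\<^sup>+s. ennreal (indicator {0..1} s * s powr a) \<partial>lborel) = ennreal (1 / (a + 1))"
    by (intro nn_integral_has_integral_lebesgue) auto
  also have "(\<integral>\<^sup>+s. ennreal (indicator {0..1} s * s powr a) \<partial>lborel)
      = (\<integral>\<^sup>+s. indicator {0<..1} s * ennreal (s powr a) \<partial>lborel)"
    using assms by (intro nn_integral_cong) (auto simp: indicator_def)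
  finally show ?thesis .
qed

text \<open>
  Slicing \<open>1 - M\<close> by the levels of \<open>M\<close> gives the integral of \<open>s powr (n / p)\<close> over the unit interval, because
  the sublevel set at \<open>s\<close> is the unit sublevel set dilated by \<open>s powr (1 / p)\<close>. Working with
  \<open>1 - M\<close> truncated at zero restricts to the unit sublevel set automatically.
\<close>

lemma nn_integral_homogeneous_sublevel:
  fixes M :: "'a::euclidean_space \<Rightarrow> real"
  assumes p: "0 < p" and scale: "\<And>c x. 0 < c \<Longrightarrow> M (c *\<^sub>R x) = c powr p * M x"
    and nonneg: "\<And>x. 0 \<le> M x" and [measurable]: "M \<in> borel_measurable borel"
    and bdd: "bounded {x. M x \<le> 1}"
  shows "(\<integral>\<^sup>+x. indicator {x. M x \<le> 1} x * ennreal (M x) \<partial>lborel)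
    = ennreal (real DIM('a) / (real DIM('a) + p) * measure lborel {x. M x \<le> 1})"
proof -
  let ?n = "real DIM('a)" and ?P = "{x. M x \<le> 1}"
  define v where "v = measure lborel ?P"
  define w where "w = p / (?n + p) * v"
  have n: "0 < ?n" by simp
  have P: "?P \<in> sets borel" by measurable
  have v: "emeasure lborel ?P = ennreal v"
    using bounded_borel_fmeasurable[OF P bdd] by (simp add: v_def emeasure_eq_measure2)
  have w: "0 \<le> w" using n p by (simp add: w_def v_def)
  have sublevel: "emeasure lborel {x. M x \<le> s} = ennreal (s powr (?n / p)) * ennreal v" if s: "0 < s" for s
  proof -
    let ?c = "s powr (1 / p)"
    have c: "0 < ?c" using s by simp
    have "(\<lambda>x. ?c *\<^sub>R x) -` {x. M x \<le> s} = ?P"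
      using s p by (auto simp: scale[OF c] powr_powr)
    moreover have "?c ^ DIM('a) = s powr (?n / p)"
      using s by (simp add: powr_realpow[symmetric] powr_powr)
    ultimately show ?thesis
      using emeasure_lborel_scaleR_vimage[of "{x. M x \<le> s}" ?c] c v by simp
  qed
  have slice: "ennreal (1 - M x) = (\<integral>\<^sup>+s. indicator {0<..1} s * indicator {x. M x \<le> s} x \<partial>lborel)" for x
  proof -
    have "(\<integral>\<^sup>+s. indicator {0<..1} s * indicator {x. M x \<le> s} x \<partial>lborel)
        = (\<integral>\<^sup>+s. (indicator ({0<..1} \<inter> {M x..}) s :: ennreal) \<partial>lborel)"
      by (intro nn_integral_cong) (auto simp: indicator_def)
    also have "\<dots> = emeasure lborel ({0<..1} \<inter> {M x..})" by simp
    also have "\<dots> = ennreal (1 - M x)"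
    proof (cases "M x = 0")
      case True
      then have "{0<..1} \<inter> {M x..} = {0<..1}" by auto
      then show ?thesis using True by simp
    next
      case False
      then have "{0<..1} \<inter> {M x..} = {M x..1}" using nonneg[of x] by auto
      then show ?thesis by (simp add: emeasure_lborel_Icc_eq ennreal_neg)
    qed
    finally show ?thesis by simp
  qed
  have "(\<integral>\<^sup>+x. ennreal (1 - M x) \<partial>lborel)
      = (\<integral>\<^sup>+x. (\<integral>\<^sup>+s. indicator {0<..1} s * indicator {x. M x \<le> s} x \<partial>lborel) \<partial>lborel)"
    by (simp only: slice)
  also have "\<dots> = (\<integral>\<^sup>+s. (\<integral>\<^sup>+x. indicator {0<..1} s * indicator {x. M x \<le> s} x \<partial>lborel) \<partial>lborel)"
    by (rule lborel_pair.Fubini') measurable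
  also have "\<dots> = (\<integral>\<^sup>+s. indicator {0<..1} s * ennreal (s powr (?n / p)) * ennreal v \<partial>lborel)"
  proof (rule nn_integral_cong)
    fix s :: real
    show "(\<integral>\<^sup>+x. indicator {0<..1} s * indicator {x. M x \<le> s} x \<partial>lborel)
        = indicator {0<..1} s * ennreal (s powr (?n / p)) * ennreal v"
      by (cases "0 < s") (auto simp: nn_integral_cmult sublevel mult.assoc)
  qed
  also have "\<dots> = (\<integral>\<^sup>+s. indicator {0<..1} s * ennreal (s powr (?n / p)) \<partial>lborel) * ennreal v"
    by (rule nn_integral_multc) measurable
  also have "\<dots> = ennreal (1 / (?n / p + 1)) * ennreal v"
    using p n by (subst nn_integral_powr_unit_interval) auto
  also have "\<dots> = ennreal w"
    using p n by (simp add: ennreal_mult[symmetric] w_def v_def field_simps)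
  finally have outer: "(\<integral>\<^sup>+x. ennreal (1 - M x) \<partial>lborel) = ennreal w" .
  let ?A = "\<integral>\<^sup>+x. indicator ?P x * ennreal (M x) \<partial>lborel"
  have "?A + ennreal w = (\<integral>\<^sup>+x. indicator ?P x * ennreal (M x) + ennreal (1 - M x) \<partial>lborel)"
    unfolding outer[symmetric] by (rule nn_integral_add[symmetric]) measurable
  also have "\<dots> = (\<integral>\<^sup>+x. indicator ?P x \<partial>lborel)"
  proof (rule nn_integral_cong)
    fix x
    show "indicator ?P x * ennreal (M x) + ennreal (1 - M x) = indicator ?P x"
      using nonneg[of x] by (cases "M x \<le> 1") (auto simp: ennreal_plus[symmetric] ennreal_neg simp del: ennreal_plus)
  qed
  also have "\<dots> = ennreal v" using v P by simp
  finally have sum: "?A + ennreal w = ennreal v" .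
  then have "?A \<noteq> top" by auto
  then obtain a where a: "0 \<le> a" "?A = ennreal a" by (cases ?A) auto
  then have "a + w = v"
    using sum w by (simp add: ennreal_plus[symmetric] v_def del: ennreal_plus)
  then have "a = ?n / (?n + p) * v" using n p by (simp add: w_def field_simps)
  then show ?thesis using a by (simp add: v_def)
qed

theorem theorem1p3:
  fixes p :: real and k :: "'n::finite" and L :: "'n \<Rightarrow> (real ^ 'n) set"
  assumes "CARD('n) \<ge> 2"
    and "p \<ge> 1"
    and "\<And>i. i \<noteq> k \<Longrightarrow> convex_body (L i)"
  shows "vol (polar_body (N_body p k L))
    \<le> a_const TYPE('n) p *
       (\<Prod>i\<in>UNIV - {k}. vol (L i) powr (- ((real CARD('n) + p) / p)))"
proof -
  note p = assms(2) and L = assms(3)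
  let ?n = "real CARD('n)"
  define P where "P = {\<xi>. simplex_moment p k L \<xi> \<le> 1}"
  define v where "v = measure lborel P"
  define b where "b = b_const TYPE('n) p"
  define q where "q = (?n + p) / ?n"
  define m where "m i = measure lborel (L i)" for i
  define D where "D = (\<Prod>i\<in>UNIV - {k}. m i powr q)"
  have n: "0 < ?n" by simp
  have b: "0 < b" unfolding b_def by (rule b_const_pos[OF p])
  have m: "0 < m i" if "i \<noteq> k" for i
    using convex_bodyD(4)[OF L[OF that]] bounded_borel_fmeasurable[OF convex_bodyD(2,3)[OF L[OF that]]]
    by (simp add: m_def emeasure_eq_measure2)
  have D: "0 < D" unfolding D_def
  proof (intro prod_pos ballI)
    fix i assume "i \<in> UNIV - {k}"
    then show "0 < m i powr q" using m[of i] by simp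
  qed
  have P: "convex P" "bounded P" "P \<in> sets borel"
    unfolding P_def by (rule unit_sublevel_set[of p k L, OF p L]; assumption)+
  have vol_P: "vol (polar_body (N_body p k L)) = v"
    using polar_N_body[of p k L, OF p L] P(3) by (simp add: P_def v_def measure_lebesgue_eq_lborel)
  have vol_L: "vol (L i) = m i" if "i \<noteq> k" for i
    using convex_bodyD(2)[OF L[OF that]] by (simp add: m_def measure_lebesgue_eq_lborel)
  \<comment> \<open>The polar body itself takes the free slot in the random simplex inequality.\<close>
  have "ennreal (b * (\<Prod>i\<in>UNIV. measure lborel ((L(k := P)) i) powr q)) \<le> det_moment p (L(k := P))"
    unfolding b_def q_def using P convex_bodyD[OF L] p by (intro busemann_random_simplex) auto
  also have "(\<Prod>i\<in>UNIV. measure lborel ((L(k := P)) i) powr q) = v powr q * D"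
    by (subst prod.remove[of _ k]) (auto simp: v_def D_def m_def intro!: prod.cong)
  also have "det_moment p (L(k := P)) = (\<integral>\<^sup>+\<xi>. indicator P \<xi> * ennreal (simplex_moment p k L \<xi>) \<partial>lborel)"
    by (rule det_moment_fun_upd[of p k L, OF p L P(3)])
  also have "\<dots> = ennreal (?n / (?n + p) * v)"
    using nn_integral_homogeneous_sublevel[of p "simplex_moment p k L"] p P(2)
      simplex_moment_scale[of p k L, OF p L] simplex_moment_nonneg[of p k L, OF p L]
      borel_measurable_continuous_onI[OF continuous_simplex_moment[of p k L, OF p L]]
    by (simp add: P_def v_def)
  finally have main: "b * (v powr q * D) \<le> ?n / (?n + p) * v"
    using p n by (subst (asm) ennreal_le_iff) (auto simp: v_def)
  have "v \<le> ((?n + p) / ?n * b) powr (- (?n / p)) * D powr (- (?n / p))"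
  proof (cases "v = 0")
    case True
    then show ?thesis by simp
  next
    case False
    then have v: "0 < v" by (simp add: v_def zero_less_measure_iff)
    have "v powr q = v * v powr (p / ?n)"
      using v n by (simp add: q_def add_divide_distrib powr_add)
    then have "v * (b * D * v powr (p / ?n)) \<le> v * (?n / (?n + p))"
      using main by (simp add: mult_ac)
    then have "b * D * v powr (p / ?n) \<le> ?n / (?n + p)"
      using v by (simp only: mult_le_cancel_left_pos)
    then have "v powr (p / ?n) \<le> ?n / (?n + p) / (b * D)"
      using b D by (subst pos_le_divide_eq) (simp_all add: mult_ac)
    also have "\<dots> = inverse ((?n + p) / ?n * b * D)"
      by (simp add: divide_inverse mult_ac)
    finally have "(v powr (p / ?n)) powr (?n / p) \<le> inverse ((?n + p) / ?n * b * D) powr (?n / p)"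
      using n p by (intro powr_mono2) auto
    also have "(v powr (p / ?n)) powr (?n / p) = v" using v n p by (simp add: powr_powr)
    also have "inverse ((?n + p) / ?n * b * D) powr (?n / p) = ((?n + p) / ?n * b * D) powr (- (?n / p))"
      unfolding powr_minus by (rule inverse_powr)
    also have "\<dots> = ((?n + p) / ?n * b) powr (- (?n / p)) * D powr (- (?n / p))"
      using b D n p by (intro powr_mult)
    finally show ?thesis .
  qed
  also have "D powr (- (?n / p)) = (\<Prod>i\<in>UNIV - {k}. m i powr (- ((?n + p) / p)))"
  proof -
    have "D powr (- (?n / p)) = (\<Prod>i\<in>UNIV - {k}. (m i powr q) powr (- (?n / p)))"
      unfolding D_def by (rule prod_powr_distrib)
    also have "\<dots> = (\<Prod>i\<in>UNIV - {k}. m i powr (- ((?n + p) / p)))"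
      using n by (simp add: powr_powr q_def)
    finally show ?thesis .
  qed
  also have "\<dots> = (\<Prod>i\<in>UNIV - {k}. vol (L i) powr (- ((?n + p) / p)))"
    by (intro prod.cong) (auto simp: vol_L)
  finally show ?thesis by (simp add: vol_P a_const_def b_def)
qed

end
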